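(* For each real $\beta>1$ the set of $x\in[0,1)$ which are normal with respect to the $\beta$-expansion is a $\mathbf{\Pi}^0_3$-complete set.
   Context: Let $T_\beta(x)=\beta x\bmod 1=\beta x-\lfloor\beta x\rfloor$ on $[0,1)$. The Parry measure $\mu_\beta$ is the unique ergodic $T_\beta$-invariant Borel probability measure on $[0,1)$ that is equivalent to Lebesgue measure (i.e. has the same null sets). A real number $x\in[0,1)$ is normal with respect to the $\beta$-expansion if $x$ generates $\mu_\beta$, i.e. $\lim_{N\to\infty}\frac1N|\{0\le n<N: T_\beta^n(x)\in I\}|=\mu_\beta(I)$ for every interval $I\subseteq[0,1)$. In a Polish space: $\mathbf{\Sigma}^0_1$ = open sets, $\mathbf{\Pi}^0_k$ = complements of $\mathbf{\Sigma}^0_k$ sets, $\mathbf{\Sigma}^0_{k+1}$ = countable unions of $\mathbf{\Pi}^0_k$ sets. A set is $\mathbf{\Pi}^0_3$-complete if it is in $\mathbf{\Pi}^0_3\setminus\mathbf{\Sigma}^0_3$. *)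

theory Defs
  imports "HOL-Probability.Probability"
begin

definition beta_map :: "real \<Rightarrow> real \<Rightarrow> real" where
  "beta_map \<beta> x = frac (\<beta> * x)"

definition invariant_measure :: "('a \<Rightarrow> 'a) \<Rightarrow> 'a measure \<Rightarrow> bool" where
  "invariant_measure T M \<longleftrightarrow>
     T \<in> measurable M M \<and>
     (\<forall>A\<in>sets M. emeasure M (T -` A \<inter> space M) = emeasure M A)"

definition ergodic_measure :: "('a \<Rightarrow> 'a) \<Rightarrow> 'a measure \<Rightarrow> bool" where
  "ergodic_measure T M \<longleftrightarrow>
     (\<forall>A\<in>sets M. T -` A \<inter> space M = A \<longrightarrow> emeasure M A = 0 \<or> emeasure M (space M - A) = 0)"

text \<open>The condition on \<open>sets M\<close> also fixes \<open>space M = {0..<1}\<close>.\<close>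

definition is_parry_measure :: "real \<Rightarrow> real measure \<Rightarrow> bool" where
  "is_parry_measure \<beta> M \<longleftrightarrow>
     sets M = sets (restrict_space borel {0..<1}) \<and>
     prob_space M \<and>
     invariant_measure (beta_map \<beta>) M \<and>
     ergodic_measure (beta_map \<beta>) M \<and>
     null_sets M = null_sets (restrict_space lborel {0..<1})"

definition parry_measure :: "real \<Rightarrow> real measure" where
  "parry_measure \<beta> = (THE M. is_parry_measure \<beta> M)"

definition beta_normal :: "real \<Rightarrow> real \<Rightarrow> bool" where
  "beta_normal \<beta> x \<longleftrightarrow>
     (\<forall>I. is_interval I \<and> I \<subseteq> {0..<1} \<longrightarrow>
        (\<lambda>N. real (card {n. n < N \<and> (beta_map \<beta> ^^ n) x \<in> I}) / real N)
          \<longlonglongrightarrow> measure (parry_measure \<beta>) I)"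

text \<open>The finite levels of the Borel hierarchy of a topological space, indexed from 1; both
  classes are empty at index 0.\<close>

inductive Sigma0_in :: "'a topology \<Rightarrow> nat \<Rightarrow> 'a set \<Rightarrow> bool"
  and Pi0_in :: "'a topology \<Rightarrow> nat \<Rightarrow> 'a set \<Rightarrow> bool"
  for X :: "'a topology"
where
  Sigma0_open: "openin X S \<Longrightarrow> Sigma0_in X 1 S"
| Pi0_compl: "Sigma0_in X k S \<Longrightarrow> Pi0_in X k (topspace X - S)"
| Sigma0_Union: "(\<And>n::nat. Pi0_in X k (A n)) \<Longrightarrow> Sigma0_in X (Suc k) (\<Union>n. A n)"

definition Pi03_complete_in :: "'a topology \<Rightarrow> 'a set \<Rightarrow> bool" where
  "Pi03_complete_in X S \<longleftrightarrow> Pi0_in X 3 S \<and> \<not> Sigma0_in X 3 S"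

end

theory Submission
  imports Defs
begin

text \<open>The Parry measure exists by Parry's explicit density, and it is unique because Birkhoff averages
  determine an ergodic measure on a set that is not null. By Weierstrass approximation, normality
  of \<open>x\<close> means convergence of the averages of \<open>(T\<^sup>n x)\<^sup>k\<close> for every \<open>k\<close>. Since all iterates of \<open>T\<close> are
  continuous off a countable set of points that are not normal, this is a \<open>\<Pi>\<^sub>3\<close> condition.

  For the lower bound, take a normal \<open>y\<close> and cut its digits into blocks of length \<open>2\<^sup>k\<close>. Decreasing a
  single digit of a block makes its cylinder full, so that any digits may follow. Inserting about
  \<open>2\<^sup>k / (z k + 1)\<close> zeros after the \<open>k\<close>-th block gives a point, depending continuously on \<open>z\<close>, that is
  normal if and only if \<open>z k\<close> tends to infinity. A Baire category argument shows that the set of such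
  sequences \<open>z\<close> is not \<open>\<Sigma>\<^sub>3\<close>.\<close>

section \<open>Birkhoff's ergodic theorem for bounded functions\<close>

text \<open>Not every digit string is a beta-expansion, so zeros cannot be inserted into the digits
  of \<open>y\<close> at will: after a digit block everything is allowed only if
  \<open>T ^^ n\<close> maps its cylinder onto \<open>[0,1)\<close>. Passing to full cylinders buys
  this freedom, and the price, the total distance between the old and the new orbit over one block,
  is at most \<open>1 + 2 * \<kappa>\<close> whatever the block length. Doubling block lengths then
  serve two purposes. Up to time \<open>N\<close> there are only about \<open>log N\<close> blocks,
  so these prices vanish in the averages; and a run of about \<open>2 ^ k / (z k + 1)\<close> zeros
  is a fixed proportion of the elapsed time along those \<open>k\<close> for which
  \<open>z k\<close> stays bounded. Powers suit the comparison because they are Lipschitz on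
  \<open>[0,1]\<close>, which indicators of intervals are not. Runs of zeros are a visible defect
  because \<open>\<mu>\<close> has positive mean. Uniqueness is what gives the definite description
  \<open>parry_measure\<close> its meaning.\<close>

definition birkhoff_sum :: "('a \<Rightarrow> 'a) \<Rightarrow> ('a \<Rightarrow> real) \<Rightarrow> nat \<Rightarrow> 'a \<Rightarrow> real" where
  "birkhoff_sum T f n x = (\<Sum>i<n. f ((T ^^ i) x))"

lemma birkhoff_sum_0 [simp]: "birkhoff_sum T f 0 x = 0"
  by (simp add: birkhoff_sum_def)

lemma birkhoff_sum_add:
  "birkhoff_sum T f (m + n) x = birkhoff_sum T f m x + birkhoff_sum T f n ((T ^^ m) x)"
proof (induction n)
  case (Suc n)
  have "(T ^^ (m + n)) x = (T ^^ n) ((T ^^ m) x)"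
    by (simp add: funpow_add add.commute[of m])
  with Suc show ?case by (simp add: birkhoff_sum_def)
qed simp

lemma birkhoff_sum_Suc_shift: "birkhoff_sum T f (Suc n) x = f x + birkhoff_sum T f n (T x)"
  using birkhoff_sum_add[of T f 1 n x] by (simp add: birkhoff_sum_def)

lemma birkhoff_sum_diff_const: "birkhoff_sum T (\<lambda>x. f x - c) n x = birkhoff_sum T f n x - c * real n"
  by (simp add: birkhoff_sum_def sum_subtractf)

lemma measurable_birkhoff_sum [measurable]:
  assumes [measurable]: "T \<in> measurable M M" "f \<in> borel_measurable M"
  shows "birkhoff_sum T f n \<in> borel_measurable M"
  unfolding birkhoff_sum_def[abs_def] by measurable

text \<open>The recursion computes the maximum of the Birkhoff sums of length at most \<open>n\<close>; it is the
  form in which the integrand \<open>f\<close> telescopes in the maximal inequality.\<close>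

primrec max_birkhoff_sum :: "('a \<Rightarrow> 'a) \<Rightarrow> ('a \<Rightarrow> real) \<Rightarrow> nat \<Rightarrow> 'a \<Rightarrow> real" where
  "max_birkhoff_sum T f 0 = (\<lambda>x. 0)"
| "max_birkhoff_sum T f (Suc n) = (\<lambda>x. max 0 (f x + max_birkhoff_sum T f n (T x)))"

lemma max_birkhoff_sum_nonneg: "0 \<le> max_birkhoff_sum T f n x"
  by (cases n) auto

lemma max_birkhoff_sum_le_Suc: "max_birkhoff_sum T f n x \<le> max_birkhoff_sum T f (Suc n) x"
proof (induction n arbitrary: x)
  case (Suc n)
  have "f x + max_birkhoff_sum T f n (T x) \<le> f x + max_birkhoff_sum T f (Suc n) (T x)"
    using Suc by (rule add_left_mono)
  then show ?case unfolding max_birkhoff_sum.simps(2)[of T f n] max_birkhoff_sum.simps(2)[of T f "Suc n"]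
    by (intro max.mono order_refl)
qed simp

lemma birkhoff_sum_le_max: "birkhoff_sum T f n x \<le> max_birkhoff_sum T f n x"
proof (induction n arbitrary: x)
  case (Suc n)
  from Suc[of "T x"] show ?case by (simp add: birkhoff_sum_Suc_shift max.coboundedI2)
qed simp

lemma measurable_max_birkhoff_sum [measurable]:
  assumes [measurable]: "T \<in> measurable M M" "f \<in> borel_measurable M"
  shows "max_birkhoff_sum T f n \<in> borel_measurable M"
proof (induction n)
  case (Suc n)
  note Suc [measurable]
  show ?case by simp
qed simp

lemma max_birkhoff_sum_le:
  assumes "T \<in> space M \<rightarrow> space M" "\<And>x. x \<in> space M \<Longrightarrow> f x \<le> B" "0 \<le> B" "x \<in> space M"
  shows "max_birkhoff_sum T f n x \<le> B * real n"
  using assms(4)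
proof (induction n arbitrary: x)
  case (Suc n)
  have "T x \<in> space M" using Suc.prems assms(1) by auto
  with Suc.IH[of "T x"] assms(2)[OF Suc.prems] assms(3)
  show ?case by (auto simp: algebra_simps)
qed simp

lemma invariant_measure_distr:
  assumes "invariant_measure T M"
  shows "distr M M T = M"
  using assms by (intro measure_eqI) (auto simp: invariant_measure_def emeasure_distr)

text \<open>Garsia's argument: where the maximum of length \<open>k + 1\<close> is positive, it
  exceeds the maximum of length \<open>k\<close> at \<open>T x\<close> by exactly
  \<open>f x\<close>; elsewhere the difference is at most \<open>0\<close>. The integral of this
  difference is nonnegative, since \<open>T\<close> preserves integrals and the maxima increase with
  their length.\<close>

lemma maximal_ergodic_inequality:
  assumes "prob_space M" and inv: "invariant_measure T M"
    and f [measurable]: "f \<in> borel_measurable M"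
    and bound: "\<And>x. x \<in> space M \<Longrightarrow> \<bar>f x\<bar> \<le> B"
  shows "0 \<le> (\<integral>x. f x * indicator {x. max_birkhoff_sum T f n x > 0} x \<partial>M)"
proof -
  interpret prob_space M by fact
  have T [measurable]: "T \<in> measurable M M" using inv by (simp add: invariant_measure_def)
  have T': "T \<in> space M \<rightarrow> space M" using measurable_space[OF T] by auto
  obtain x0 where "x0 \<in> space M" using not_empty by blast
  then have B: "0 \<le> B" using bound[of x0] by linarith
  let ?m = "max_birkhoff_sum T f"
  have upper: "?m n x \<le> B * real n" if "x \<in> space M" for n x
    using that bound by (intro max_birkhoff_sum_le[OF T' _ B]) (auto simp: abs_le_iff)
  have int: "integrable M (?m n)" for n
    using upper by (intro integrable_const_bound[where B = "B * real n"])
      (auto simp: max_birkhoff_sum_nonneg)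
  have int': "integrable M (\<lambda>x. ?m n (T x))" for n
    using integrable_distr[OF T, of "?m n"] int[of n] by (simp add: invariant_measure_distr[OF inv])
  have eq: "(\<integral>x. ?m n (T x) \<partial>M) = (\<integral>x. ?m n x \<partial>M)" for n
    using integral_distr[OF T, of "?m n"] invariant_measure_distr[OF inv] by simp
  show ?thesis
  proof (cases n)
    case (Suc k)
    have "(\<integral>x. ?m k x \<partial>M) \<le> (\<integral>x. ?m (Suc k) x \<partial>M)"
      by (intro integral_mono int max_birkhoff_sum_le_Suc)
    then have "0 \<le> (\<integral>x. ?m (Suc k) x - ?m k (T x) \<partial>M)"
      using int int' by (simp add: eq del: max_birkhoff_sum.simps)
    also have "\<dots> \<le> (\<integral>x. f x * indicator {x. ?m (Suc k) x > 0} x \<partial>M)"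
    proof (rule integral_mono)
      show "integrable M (\<lambda>x. ?m (Suc k) x - ?m k (T x))"
        using int int' by (simp del: max_birkhoff_sum.simps)
      show "integrable M (\<lambda>x. f x * indicator {x. ?m (Suc k) x > 0} x)"
      proof (rule integrable_const_bound[where B = B])
        show "AE x in M. norm (f x * indicator {x. ?m (Suc k) x > 0} x) \<le> B"
          using bound B by (intro AE_I2) (auto simp: indicator_def)
        show "(\<lambda>x. f x * indicator {x. ?m (Suc k) x > 0} x) \<in> borel_measurable M"
          by (simp del: max_birkhoff_sum.simps)
      qed
    next
      fix x
      show "?m (Suc k) x - ?m k (T x) \<le> f x * indicator {x. ?m (Suc k) x > 0} x"
        using max_birkhoff_sum_nonneg[of T f k "T x"] by (auto simp: indicator_def)
    qed
    finally show ?thesis by (simp add: Suc del: max_birkhoff_sum.simps)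
  qed simp
qed

text \<open>The exceptional set \<open>E\<close>, where the sums exceed \<open>c * n\<close> by an
  unbounded amount, is exactly invariant, because a shift changes the excess by a bounded quantity.
  If its complement were null, the indicators in the maximal inequality for \<open>f - c\<close>
  would tend to \<open>1\<close> almost everywhere, giving \<open>c\<close> at most the integral of
  \<open>f\<close>.\<close>

lemma birkhoff_upper_bound:
  assumes "prob_space M" and inv: "invariant_measure T M" and erg: "ergodic_measure T M"
    and f [measurable]: "f \<in> borel_measurable M"
    and bound: "\<And>x. x \<in> space M \<Longrightarrow> \<bar>f x\<bar> \<le> B"
    and c: "(\<integral>x. f x \<partial>M) < c"
  shows "AE x in M. \<exists>K. \<forall>n. birkhoff_sum T f n x \<le> c * real n + K"
proof -
  interpret prob_space M by fact
  have T [measurable]: "T \<in> measurable M M" using inv by (simp add: invariant_measure_def)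
  define E where "E = {x \<in> space M. \<forall>k::nat. \<exists>n. birkhoff_sum T f n x > c * real n + real k}"
  have E [measurable]: "E \<in> sets M" unfolding E_def by measurable
  have E_iff: "x \<in> E \<longleftrightarrow> (\<forall>K. \<exists>n. birkhoff_sum T f n x > c * real n + K)" if "x \<in> space M" for x
  proof
    assume x: "x \<in> E"
    show "\<forall>K. \<exists>n. birkhoff_sum T f n x > c * real n + K"
    proof
      fix K
      obtain k :: nat where "K \<le> real k" using real_arch_simple by blast
      moreover obtain n where "birkhoff_sum T f n x > c * real n + real k"
        using x by (auto simp: E_def)
      ultimately show "\<exists>n. birkhoff_sum T f n x > c * real n + K" by (intro exI[of _ n]) auto
    qed
  qed (use that in \<open>auto simp: E_def\<close>)
  have E_invariant: "T x \<in> E \<longleftrightarrow> x \<in> E" if x: "x \<in> space M" for x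
  proof -
    have Tx: "T x \<in> space M" using measurable_space[OF T x] .
    have shift: "birkhoff_sum T f n (T x) > c * real n + K \<longleftrightarrow>
        birkhoff_sum T f (Suc n) x > c * real (Suc n) + (K + f x - c)" for n K
      by (simp add: birkhoff_sum_Suc_shift algebra_simps)
    show ?thesis unfolding E_iff[OF x] E_iff[OF Tx]
    proof (intro iffI allI)
      fix K
      assume "\<forall>K. \<exists>n. birkhoff_sum T f n (T x) > c * real n + K"
      then obtain n where "birkhoff_sum T f n (T x) > c * real n + (K - f x + c)" by blast
      then show "\<exists>n. birkhoff_sum T f n x > c * real n + K"
        by (intro exI[of _ "Suc n"]) (auto simp: shift)
    next
      fix K
      assume "\<forall>K. \<exists>n. birkhoff_sum T f n x > c * real n + K"
      \<comment> \<open>The \<open>max 0\<close> excludes \<open>n = 0\<close>, where the sum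
        vanishes, so \<open>n\<close> has a predecessor.\<close>
      then obtain n where n: "birkhoff_sum T f n x > c * real n + max 0 (K + f x - c)" by blast
      then obtain m where "n = Suc m" by (cases n) auto
      then show "\<exists>n. birkhoff_sum T f n (T x) > c * real n + K"
        using n by (intro exI[of _ m]) (auto simp: shift)
    qed
  qed
  have "T -` E \<inter> space M = E" using E_invariant sets.sets_into_space[OF E] by blast
  then have "emeasure M E = 0 \<or> emeasure M (space M - E) = 0"
    using erg E by (auto simp: ergodic_measure_def)
  moreover have "emeasure M (space M - E) \<noteq> 0"
  proof
    assume "emeasure M (space M - E) = 0"
    then have "AE x in M. x \<in> E"
      by (intro AE_I[of _ _ "space M - E"]) auto
    define g where "g = (\<lambda>x. f x - c)"
    have [measurable]: "g \<in> borel_measurable M" unfolding g_def by measurable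
    have g_bound: "\<bar>g x\<bar> \<le> B + \<bar>c\<bar>" if "x \<in> space M" for x
      using bound[OF that] unfolding g_def by linarith
    let ?I = "\<lambda>n x. indicator {x. max_birkhoff_sum T g n x > 0} x :: real"
    have "(\<lambda>n. \<integral>x. g x * ?I n x \<partial>M) \<longlonglongrightarrow> (\<integral>x. g x \<partial>M)"
    proof (rule integral_dominated_convergence)
      show "integrable M (\<lambda>x. B + \<bar>c\<bar>)" by simp
      show "AE x in M. (\<lambda>n. g x * ?I n x) \<longlonglongrightarrow> g x"
        using \<open>AE x in M. x \<in> E\<close>
      proof eventually_elim
        case (elim x)
        then have "x \<in> space M" by (simp add: E_def)
        then obtain m where "birkhoff_sum T f m x > c * real m + 0" using elim E_iff by blast
        then have "birkhoff_sum T g m x > 0"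
          unfolding g_def birkhoff_sum_diff_const by simp
        then have "max_birkhoff_sum T g m x > 0"
          using birkhoff_sum_le_max[of T g m x] by linarith
        then have "max_birkhoff_sum T g n x > 0" if "m \<le> n" for n
          using lift_Suc_mono_le[of "\<lambda>n. max_birkhoff_sum T g n x", OF max_birkhoff_sum_le_Suc that]
          by linarith
        then have "eventually (\<lambda>n. g x * ?I n x = g x) sequentially"
          by (intro eventually_sequentiallyI[of m]) auto
        then show ?case by (rule tendsto_eventually)
      qed
      show "AE x in M. norm (g x * ?I n x) \<le> B + \<bar>c\<bar>" for n
      proof (rule AE_I2)
        fix x assume "x \<in> space M"
        then show "norm (g x * ?I n x) \<le> B + \<bar>c\<bar>"
          using g_bound[of x] by (auto simp: indicator_def)
      qed
      show "(\<lambda>x. g x * ?I n x) \<in> borel_measurable M" for n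
        by measurable
    qed simp_all
    moreover have "0 \<le> (\<integral>x. g x * ?I n x \<partial>M)" for n
      using g_bound by (intro maximal_ergodic_inequality[OF \<open>prob_space M\<close> inv]) auto
    ultimately have "0 \<le> (\<integral>x. g x \<partial>M)"
      by (intro LIMSEQ_le_const) auto
    moreover have "integrable M f" using bound by (intro integrable_const_bound[of _ B]) auto
    then have "(\<integral>x. g x \<partial>M) = (\<integral>x. f x \<partial>M) - c"
      unfolding g_def by (simp add: prob_space)
    ultimately show False using c by simp
  qed
  ultimately have "emeasure M E = 0" by blast
  then have "AE x in M. x \<notin> E" by (intro AE_I[of _ _ E]) auto
  then show ?thesis
    by (rule AE_mp) (auto intro!: AE_I2 simp: E_iff not_less)
qed

text \<open>The upper bound is applied to \<open>f\<close> and to \<open>- f\<close>, with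
  \<open>c\<close> above the respective mean by \<open>1 / Suc j\<close>; the additive constants
  disappear on division by \<open>n\<close>.\<close>

theorem birkhoff_ergodic:
  assumes "prob_space M" and inv: "invariant_measure T M" and erg: "ergodic_measure T M"
    and f [measurable]: "f \<in> borel_measurable M"
    and bound: "\<And>x. x \<in> space M \<Longrightarrow> \<bar>f x\<bar> \<le> B"
  shows "AE x in M. (\<lambda>n. birkhoff_sum T f n x / real n) \<longlonglongrightarrow> (\<integral>x. f x \<partial>M)"
proof -
  interpret prob_space M by fact
  let ?q = "\<integral>x. f x \<partial>M"
  have "AE x in M. \<forall>j::nat. \<exists>K. \<forall>n. birkhoff_sum T f n x \<le> (?q + 1 / Suc j) * real n + K"
    unfolding AE_all_countable
    by (intro allI birkhoff_upper_bound[OF assms(1) inv erg f bound]) auto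
  moreover have "AE x in M. \<forall>j::nat. \<exists>K. \<forall>n.
      birkhoff_sum T (\<lambda>x. - f x) n x \<le> (- ?q + 1 / Suc j) * real n + K"
    unfolding AE_all_countable
    by (intro allI birkhoff_upper_bound[OF assms(1) inv erg, where B = B]) (use bound in auto)
  ultimately show ?thesis
  proof eventually_elim
    case (elim x)
    have neg: "birkhoff_sum T (\<lambda>x. - f x) n x = - birkhoff_sum T f n x" for n
      by (simp add: birkhoff_sum_def sum_negf)
    show ?case
    proof (rule LIMSEQ_I)
      fix e :: real assume "e > 0"
      then obtain j :: nat where j: "1 / Suc j < e / 2"
        using nat_approx_posE[of "e/2"] by auto
      obtain K where K: "\<And>n. birkhoff_sum T f n x \<le> (?q + 1 / Suc j) * real n + K"
        using elim by blast
      obtain L where L: "\<And>n. - birkhoff_sum T f n x \<le> (- ?q + 1 / Suc j) * real n + L"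
        using elim(2) unfolding neg by blast
      obtain N :: nat where N: "2 * (\<bar>K\<bar> + \<bar>L\<bar>) / e < real N" using reals_Archimedean2 by blast
      show "\<exists>no. \<forall>n\<ge>no. norm (birkhoff_sum T f n x / real n - ?q) < e"
      proof (intro exI allI impI)
        fix n assume "Suc N \<le> n"
        then have n: "real n > 0" "real N \<le> real n" by auto
        have "2 * (\<bar>K\<bar> + \<bar>L\<bar>) < real N * e" using N \<open>e > 0\<close> by (simp add: pos_divide_less_eq)
        also have "\<dots> \<le> real n * e" using n \<open>e > 0\<close> by (intro mult_right_mono) auto
        finally have KL: "2 * (\<bar>K\<bar> + \<bar>L\<bar>) < real n * e" .
        define t where "t = 1 / real (Suc j) * real n"
        have t: "2 * t < real n * e"
          using mult_strict_right_mono[OF j n(1)] unfolding t_def by (simp add: algebra_simps)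
        have "birkhoff_sum T f n x \<le> ?q * real n + t + K"
          "- birkhoff_sum T f n x \<le> - (?q * real n) + t + L"
          using K[of n] L[of n] unfolding t_def distrib_right by simp_all
        with KL t have "\<bar>birkhoff_sum T f n x - ?q * real n\<bar> < e * real n"
          using abs_ge_self[of K] abs_ge_self[of L] abs_ge_zero[of K] abs_ge_zero[of L]
          unfolding mult.commute[of e] abs_less_iff distrib_left by linarith
        moreover have "birkhoff_sum T f n x / real n - ?q = (birkhoff_sum T f n x - ?q * real n) / real n"
          using n by (simp add: field_simps)
        ultimately show "norm (birkhoff_sum T f n x / real n - ?q) < e"
          using n by (simp add: pos_divide_less_eq)
      qed
    qed
  qed
qed

section \<open>Uniqueness and ergodicity\<close>

lemma parry_measure_unique:
  assumes "is_parry_measure \<beta> M1" "is_parry_measure \<beta> M2"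
  shows "M1 = M2"
proof (rule measure_eqI)
  show sets_eq: "sets M1 = sets M2" using assms by (simp add: is_parry_measure_def)
  interpret M1: prob_space M1 using assms by (simp add: is_parry_measure_def)
  interpret M2: prob_space M2 using assms by (simp add: is_parry_measure_def)
  have space_eq: "space M1 = space M2" using sets_eq by (rule sets_eq_imp_space_eq)
  have null_eq: "null_sets M1 = null_sets M2" using assms by (simp add: is_parry_measure_def)
  \<comment> \<open>Equal null sets allow both almost sure limits to be read at one common
    point.\<close>
  have ae_eq: "ae_filter M1 = ae_filter M2"
    unfolding ae_filter_def space_eq null_eq ..
  fix A assume A [measurable]: "A \<in> sets M1"
  then have A2 [measurable]: "A \<in> sets M2" by (simp add: sets_eq)
  let ?avg = "\<lambda>x n. birkhoff_sum (beta_map \<beta>) (indicator A) n x / real n"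
  have "AE x in M1. ?avg x \<longlonglongrightarrow> (\<integral>x. indicator A x \<partial>M1)"
    using assms(1) by (intro birkhoff_ergodic[where B = 1]) (simp_all add: is_parry_measure_def)
  moreover have "AE x in M2. ?avg x \<longlonglongrightarrow> (\<integral>x. indicator A x \<partial>M2)"
    using assms(2) by (intro birkhoff_ergodic[where B = 1]) (simp_all add: is_parry_measure_def)
  then have "AE x in M1. ?avg x \<longlonglongrightarrow> (\<integral>x. indicator A x \<partial>M2)" unfolding ae_eq .
  ultimately have "AE x in M1. (\<integral>x. indicator A x \<partial>M1) = (\<integral>x. indicator A x \<partial>M2 :: real)"
    by eventually_elim (rule LIMSEQ_unique)
  then have "(\<integral>x. indicator A x \<partial>M1) = (\<integral>x. indicator A x \<partial>M2 :: real)"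
    by simp
  then have "measure M1 A = measure M2 A"
    using sets.sets_into_space[OF A] sets.sets_into_space[OF A2] by (simp add: Int_absorb2)
  then show "emeasure M1 A = emeasure M2 A"
    by (simp add: M1.emeasure_eq_measure M2.emeasure_eq_measure)
qed

section \<open>Lebesgue measure under the beta map and triviality of invariant sets\<close>

lemma measure_lborel_translate:
  assumes [measurable]: "B \<in> sets borel"
  shows "measure lborel {x :: real. c + x \<in> B} = measure lborel B"
proof -
  have "measure lborel B = measure (distr lborel borel ((+) c)) B" by (simp add: lborel_distr_plus)
  also have "\<dots> = measure lborel {x. c + x \<in> B}"
    by (subst measure_distr) (auto simp: vimage_def)
  finally show ?thesis ..
qed

lemma measure_lborel_scale:
  assumes [measurable]: "B \<in> sets borel" and "c > 0"
  shows "measure lborel {x :: real. c * x \<in> B} = measure lborel B / c"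
proof -
  have "measure lborel {x. c * x \<in> B} = measure (distr lborel borel ((*) c)) B"
    by (subst measure_distr) (auto simp: vimage_def)
  also have "\<dots> = measure lborel B / c"
    using \<open>c > 0\<close> by (subst lborel_distr_mult)
      (simp_all add: measure_density_const divide_inverse)
  finally show ?thesis .
qed

lemma fmeasurable_subset_unit:
  assumes "A \<in> sets borel" "A \<subseteq> {0..<1::real}"
  shows "A \<in> fmeasurable lborel"
proof (rule fmeasurableI)
  have "emeasure lborel A \<le> emeasure lborel {0..<1::real}"
    using assms by (intro emeasure_mono) simp_all
  also have "\<dots> < \<infinity>" by simp
  finally show "emeasure lborel A < \<infinity>" .
qed (use assms in simp)

lemma measure_subset_unit_le:
  assumes "A \<in> sets borel" "A \<subseteq> {0..<1::real}"
  shows "measure lborel A \<le> 1"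
proof -
  have "measure lborel A \<le> measure lborel {0..<1::real}"
    using assms by (intro measure_mono_fmeasurable fmeasurable_subset_unit) simp_all
  then show ?thesis by simp
qed

text \<open>A copy of \<open>A\<close> sits in each of the \<open>d\<close> full unit intervals, and
  the last, incomplete one holds a copy of \<open>A\<close> below \<open>s\<close>. The induction
  splits off the first unit interval and translates the rest by \<open>1\<close>.\<close>

lemma measure_frac_vimage:
  assumes A: "A \<in> sets borel" "A \<subseteq> {0..<1::real}" and s: "0 \<le> s" "s < 1"
  shows "measure lborel {v \<in> {0..<real d + s}. frac v \<in> A} =
    real d * measure lborel A + measure lborel (A \<inter> {0..<s})"
proof (induction d)
  case 0
  have "{v \<in> {0..<real 0 + s}. frac v \<in> A} = A \<inter> {0..<s}"
    using s A by (auto simp: frac_eq)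
  then show ?case by simp
next
  case (Suc d)
  note A(1) [measurable]
  let ?B = "\<lambda>d. {v \<in> {0..<real d + s}. frac v \<in> A}"
  let ?C = "{v. v \<in> {1..<real (Suc d) + s} \<and> frac v \<in> A}"
  have m [measurable]: "(frac :: real \<Rightarrow> real) \<in> borel_measurable borel"
    unfolding frac_def[abs_def] by measurable
  have "?B (Suc d) = A \<union> ?C"
  proof (intro set_eqI iffI)
    fix v assume "v \<in> ?B (Suc d)"
    then show "v \<in> A \<union> ?C" by (cases "v < 1") (auto simp: frac_eq[THEN iffD2])
  next
    fix v assume v: "v \<in> A \<union> ?C"
    then show "v \<in> ?B (Suc d)"
      using A s by (auto simp: frac_eq[THEN iffD2] subset_iff)
  qed
  moreover have C: "?C \<in> fmeasurable lborel"
  proof (rule fmeasurableI)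
    have "emeasure lborel ?C \<le> emeasure lborel {0..real (Suc d) + s}"
      by (intro emeasure_mono) auto
    also have "\<dots> < \<infinity>" using s by (subst emeasure_lborel_Icc) simp_all
    finally show "emeasure lborel ?C < \<infinity>" .
  qed measurable
  moreover have "A \<inter> ?C = {}" using A by force
  moreover have "A \<in> fmeasurable lborel" using A by (rule fmeasurable_subset_unit)
  ultimately have "measure lborel (?B (Suc d)) = measure lborel A + measure lborel ?C"
    by (simp add: measure_Un_AE measure_Un3)
  moreover have "measure lborel ?C = measure lborel {v. 1 + v \<in> ?C}"
    by (rule measure_lborel_translate[symmetric]) measurable
  moreover have "{v. 1 + v \<in> ?C} = ?B d"
    by (auto simp: frac_1_eq[unfolded add.commute[of _ 1]])
  ultimately show ?case using Suc.IH by (simp add: algebra_simps)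
qed

locale beta_expansion =
  fixes \<beta> :: real
  assumes beta_gt_1: "\<beta> > 1"
begin

abbreviation T where "T \<equiv> beta_map \<beta>"

lemma beta_map_range [simp]: "0 \<le> T x" "T x < 1"
  by (simp_all add: beta_map_def frac_ge_0 frac_lt_1)

lemma beta_map_measurable [measurable]: "T \<in> borel_measurable borel"
  unfolding beta_map_def[abs_def] frac_def[abs_def] by measurable

text \<open>Substituting \<open>v = \<beta> * x\<close> reduces this to unit intervals up to
  \<open>\<beta> * c\<close>. The identity is the source of both ergodicity and the invariance of
  Parry's density: the endpoint \<open>c\<close> reappears on the right as
  \<open>T c\<close>.\<close>

lemma measure_beta_map_vimage:
  assumes A: "A \<in> sets borel" "A \<subseteq> {0..<1}" and c: "0 \<le> c"
  shows "measure lborel ({0..<c} \<inter> T -` A) =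
    (of_int \<lfloor>\<beta> * c\<rfloor> * measure lborel A + measure lborel (A \<inter> {0..<T c})) / \<beta>"
proof -
  note A(1) [measurable]
  have m [measurable]: "(frac :: real \<Rightarrow> real) \<in> borel_measurable borel"
    unfolding frac_def[abs_def] by measurable
  define d where "d = nat \<lfloor>\<beta> * c\<rfloor>"
  have d: "real d = of_int \<lfloor>\<beta> * c\<rfloor>" using c beta_gt_1 by (simp add: d_def)
  have e: "real d + T c = \<beta> * c" unfolding d beta_map_def frac_def by simp
  let ?B = "{v \<in> {0..<real d + T c}. frac v \<in> A}"
  have "{0..<c} \<inter> T -` A = {x. \<beta> * x \<in> ?B}"
    using beta_gt_1 unfolding e by (auto simp: beta_map_def zero_le_mult_iff)
  then have "measure lborel ({0..<c} \<inter> T -` A) = measure lborel ?B / \<beta>"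
    using beta_gt_1 by (simp only:) (rule measure_lborel_scale, measurable)
  also have "measure lborel ?B = real d * measure lborel A + measure lborel (A \<inter> {0..<T c})"
    by (rule measure_frac_vimage[OF A]) auto
  finally show ?thesis unfolding d .
qed

text \<open>For an invariant set \<open>A\<close> the defect \<open>|A \<inter> [0,c)| - |A| c\<close> at \<open>c\<close> is \<open>1/\<beta>\<close> times the defect
  at \<open>T c\<close>; being bounded, it vanishes.\<close>

lemma invariant_set_independent:
  assumes A: "A \<in> sets borel" "A \<subseteq> {0..<1}" and inv: "T -` A \<inter> {0..<1} = A"
    and c: "0 \<le> c" "c \<le> 1"
  shows "measure lborel (A \<inter> {0..<c}) = measure lborel A * c"
proof -
  note A(1) [measurable]
  define G where "G c = measure lborel (A \<inter> {0..<c}) - measure lborel A * c" for c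
  have step: "G c = G (T c) / \<beta>" if "0 \<le> c" "c \<le> 1" for c
  proof -
    have "\<beta> * c = of_int \<lfloor>\<beta> * c\<rfloor> + T c" by (simp add: beta_map_def frac_def)
    then have "measure lborel A * (\<beta> * c) =
        of_int \<lfloor>\<beta> * c\<rfloor> * measure lborel A + measure lborel A * T c"
      by (metis distrib_left mult.commute)
    moreover have "A \<inter> {0..<c} = {0..<c} \<inter> T -` A" using inv that by auto
    then have "\<beta> * measure lborel (A \<inter> {0..<c}) =
        of_int \<lfloor>\<beta> * c\<rfloor> * measure lborel A + measure lborel (A \<inter> {0..<T c})"
      using measure_beta_map_vimage[OF A \<open>0 \<le> c\<close>] beta_gt_1 by simp
    moreover have "\<beta> * G c = \<beta> * measure lborel (A \<inter> {0..<c}) - measure lborel A * (\<beta> * c)"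
      unfolding G_def by (simp add: algebra_simps)
    ultimately have "\<beta> * G c = G (T c)"
      unfolding G_def by (simp add: algebra_simps)
    then show ?thesis using beta_gt_1 by (simp add: field_simps)
  qed
  have bound: "\<bar>G c\<bar> \<le> 1" if "0 \<le> c" "c \<le> 1" for c
  proof -
    have "measure lborel (A \<inter> {0..<c}) \<le> 1" "measure lborel A \<le> 1"
      using A by (auto intro!: measure_subset_unit_le)
    moreover have "measure lborel A * c \<le> 1"
      using that calculation(2) by (intro mult_le_one) auto
    ultimately show ?thesis using that unfolding G_def
      by (simp add: abs_le_iff) (smt (verit) measure_nonneg mult_nonneg_nonneg)
  qed
  have "\<beta> ^ n * \<bar>G c\<bar> \<le> 1" if "0 \<le> c" "c \<le> 1" for c n
    using that
  proof (induction n arbitrary: c)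
    case (Suc n)
    have "\<beta> ^ n * \<bar>G (T c)\<bar> \<le> 1" by (rule Suc.IH) (simp_all add: less_imp_le)
    moreover have "\<beta> ^ Suc n * \<bar>G c\<bar> = \<beta> ^ n * \<bar>G (T c)\<bar>"
      using beta_gt_1 unfolding step[OF Suc.prems] by simp
    ultimately show ?case by (simp only:)
  qed (use bound in auto)
  then have "\<bar>G c\<bar> \<le> (1 / \<beta>) ^ n" for n
    using c beta_gt_1 by (simp add: power_divide pos_le_divide_eq mult.commute)
  moreover have "(\<lambda>n. (1 / \<beta>) ^ n) \<longlonglongrightarrow> 0"
    using beta_gt_1 by (intro LIMSEQ_power_zero) auto
  ultimately have "\<bar>G c\<bar> \<le> 0" using c by (intro LIMSEQ_le_const) auto
  then show ?thesis unfolding G_def by simp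
qed

text \<open>Independence of \<open>A\<close> from the intervals \<open>[0,c)\<close> passes to the
  rays \<open>{x<..}\<close>, and these determine a Borel measure. Hence \<open>A\<close> is
  independent of every Borel set, in particular of itself, so its measure equals its own
  square.\<close>

lemma invariant_set_trivial:
  assumes A: "A \<in> sets borel" "A \<subseteq> {0..<1}" and inv: "T -` A \<inter> {0..<1} = A"
  shows "measure lborel A = 0 \<or> measure lborel A = 1"
proof -
  note A(1) [measurable]
  let ?a = "measure lborel A"
  have fA: "A \<in> fmeasurable lborel" using A by (rule fmeasurable_subset_unit)
  have upper: "measure lborel (A \<inter> {x<..}) = ?a * measure lborel ({0..<1} \<inter> {x<..})" for x
  proof -
    consider "x < 0" | "1 \<le> x" | "0 \<le> x" "x < 1" by linarith
    then show ?thesis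
    proof cases
      case 1
      then have "A \<inter> {x<..} = A" "{0..<1} \<inter> {x<..} = {0..<1}" using A by auto
      then show ?thesis by simp
    next
      case 2
      then have "A \<inter> {x<..} = {}" "{0..<1} \<inter> {x<..} = {}" using A by auto
      then show ?thesis by simp
    next
      case 3
      have split: "measure lborel B = measure lborel (B \<inter> {0..<x}) + measure lborel (B \<inter> {x<..})"
        if "B \<in> sets borel" "B \<subseteq> {0..<1}" for B
      proof -
        note that(1) [measurable]
        have "measure lborel B = measure lborel ((B \<inter> {0..<x}) \<union> (B \<inter> {x<..}))"
        proof (rule measure_eq_AE)
          show "AE y in lborel. y \<in> B \<longleftrightarrow> y \<in> B \<inter> {0..<x} \<union> B \<inter> {x<..}"
            using AE_lborel_singleton[of x] by eventually_elim (use that in auto)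
        qed measurable
        also have "\<dots> = measure lborel (B \<inter> {0..<x}) + measure lborel (B \<inter> {x<..})"
          using that fmeasurableD2[OF fmeasurable_subset_unit[of "B \<inter> {0..<x}"]]
            fmeasurableD2[OF fmeasurable_subset_unit[of "B \<inter> {x<..}"]]
          by (intro measure_Union) auto
        finally show ?thesis .
      qed
      have "{0..<1} \<inter> {0..<x} = {0..<x}" using 3 by auto
      then have x: "measure lborel ({0..<1} \<inter> {x<..}) = 1 - x"
        using split[of "{0..<1}"] 3 by simp
      show ?thesis
        using split[OF A] invariant_set_independent[OF A inv, of x] 3
        unfolding x by (simp add: algebra_simps)
    qed
  qed
  let ?N = "scale_measure (ennreal ?a) (density lborel (indicator {0..<1}))"
  have eqI: "emeasure (density lborel (indicator A)) B = ennreal (measure lborel (A \<inter> B))"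
    "emeasure ?N B = ennreal (?a * measure lborel ({0..<1} \<inter> B))"
    if [measurable]: "B \<in> sets borel" for B
  proof -
    have "A \<inter> B \<in> fmeasurable lborel" "{0..<1} \<inter> B \<in> fmeasurable lborel"
      using A by (auto intro!: fmeasurable_subset_unit)
    then show "emeasure (density lborel (indicator A)) B = ennreal (measure lborel (A \<inter> B))"
      "emeasure ?N B = ennreal (?a * measure lborel ({0..<1} \<inter> B))"
      by (simp_all add: emeasure_restricted emeasure_eq_measure2 ennreal_mult)
  qed
  have "density lborel (indicator A) = ?N"
    by (rule measure_eqI_lessThan) (simp_all add: eqI upper del: emeasure_scale_measure)
  then have "ennreal (measure lborel (A \<inter> A)) = ennreal (?a * measure lborel ({0..<1} \<inter> A))"
    using eqI[OF A(1)] by metis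
  moreover have "{0..<1} \<inter> A = A" using A by auto
  ultimately have "?a = ?a * ?a" by simp
  then show ?thesis by (cases "?a = 0") auto
qed

end

section \<open>Existence of the Parry measure\<close>

context beta_expansion
begin

text \<open>Parry's density is, up to normalisation, \<open>h = \<Sum>n. \<beta>\<^sup>-\<^sup>n 1\<^bsub>[0, T\<^sup>n 1)\<^esub>\<close>;
  \<open>parry_mass A\<close> is its integral over \<open>A\<close>.\<close>

definition parry_mass :: "real set \<Rightarrow> real" where
  "parry_mass A = (\<Sum>n. measure lborel (A \<inter> {0..<(T ^^ n) 1}) / \<beta> ^ n)"

definition parry_density :: "real \<Rightarrow> ennreal" where
  "parry_density x = (\<Sum>n. ennreal (1 / \<beta> ^ n) * indicator {0..<(T ^^ n) 1} x)"

lemma orbit_one_range: "0 \<le> (T ^^ n) 1" "(T ^^ n) 1 \<le> 1"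
  by (cases n; simp add: less_imp_le)+

lemma summable_geometric_beta: "summable (\<lambda>n. 1 / \<beta> ^ n)"
proof -
  have "summable (\<lambda>n. (1 / \<beta>) ^ n)" using beta_gt_1 by (intro summable_geometric) simp
  then show ?thesis by (simp add: power_divide)
qed

text \<open>This is the beta-expansion of \<open>1\<close>, obtained by telescoping
  \<open>(T ^^ n) 1 / \<beta> ^ n\<close>.\<close>

lemma sums_digits_one: "(\<lambda>n. of_int \<lfloor>\<beta> * (T ^^ n) 1\<rfloor> / \<beta> ^ Suc n) sums 1"
proof -
  have "(\<lambda>n. (T ^^ n) 1 / \<beta> ^ n) \<longlonglongrightarrow> 0"
  proof (rule tendsto_sandwich[where f = "\<lambda>n. 0" and h = "\<lambda>n. 1 / \<beta> ^ n"])
    show "(\<lambda>n. 1 / \<beta> ^ n) \<longlonglongrightarrow> 0" using summable_geometric_beta by (rule summable_LIMSEQ_zero)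
  qed (use orbit_one_range beta_gt_1 in \<open>auto intro!: always_eventually divide_right_mono\<close>)
  from telescope_sums'[OF this]
  have "(\<lambda>n. (T ^^ n) 1 / \<beta> ^ n - (T ^^ Suc n) 1 / \<beta> ^ Suc n) sums 1" by simp
  moreover have "(T ^^ n) 1 / \<beta> ^ n - (T ^^ Suc n) 1 / \<beta> ^ Suc n =
      of_int \<lfloor>\<beta> * (T ^^ n) 1\<rfloor> / \<beta> ^ Suc n" for n
    using beta_gt_1 by (simp add: beta_map_def frac_def field_simps)
  ultimately show ?thesis by (simp only:)
qed

context
  fixes A :: "real set"
  assumes A [measurable]: "A \<in> sets borel" and A_unit: "A \<subseteq> {0..<1}"
begin

lemma parry_mass_term_bound:
  "measure lborel (A \<inter> {0..<(T ^^ n) 1}) / \<beta> ^ n \<le> measure lborel A * (1 / \<beta> ^ n)"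
proof -
  have "measure lborel (A \<inter> {0..<(T ^^ n) 1}) \<le> measure lborel A"
    using fmeasurable_subset_unit[OF A A_unit] by (intro measure_mono_fmeasurable) auto
  then show ?thesis using beta_gt_1 by (simp add: divide_right_mono)
qed

lemma summable_parry_mass: "summable (\<lambda>n. measure lborel (A \<inter> {0..<(T ^^ n) 1}) / \<beta> ^ n)"
proof (rule summable_comparison_test')
  show "summable (\<lambda>n. measure lborel A * (1 / \<beta> ^ n))"
    by (intro summable_mult summable_geometric_beta)
  show "norm (measure lborel (A \<inter> {0..<(T ^^ n) 1}) / \<beta> ^ n) \<le> measure lborel A * (1 / \<beta> ^ n)"
    if "n \<ge> 0" for n
    using parry_mass_term_bound[of n] beta_gt_1 by simp
qed

text \<open>Together with \<open>parry_mass_ge\<close>, which keeps only the term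
  \<open>n = 0\<close>, this traps the mass between multiples of Lebesgue measure, so both have the
  same null sets.\<close>

lemma parry_mass_le: "parry_mass A \<le> measure lborel A * (\<Sum>n. 1 / \<beta> ^ n)"
  unfolding parry_mass_def suminf_mult[OF summable_geometric_beta, symmetric]
  by (intro suminf_le parry_mass_term_bound summable_parry_mass summable_mult summable_geometric_beta)

lemma parry_mass_ge: "measure lborel A \<le> parry_mass A"
proof -
  have "A \<inter> {0..<1} = A" using A_unit by auto
  then have "measure lborel A = (\<Sum>n<1. measure lborel (A \<inter> {0..<(T ^^ n) 1}) / \<beta> ^ n)" by simp
  also have "\<dots> \<le> parry_mass A"
    unfolding parry_mass_def using beta_gt_1 by (intro sum_le_suminf summable_parry_mass) auto
  finally show ?thesis .
qed

text \<open>Taking preimages turns the \<open>n\<close>-th term into the \<open>(n + 1)\<close>-st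
  plus the measure of \<open>A\<close> times the \<open>n\<close>-th summand of the expansion of
  \<open>1\<close>. The latter add up to the measure of \<open>A\<close>, which is precisely the
  term \<open>n = 0\<close> lost by the index shift.\<close>

lemma parry_mass_vimage: "parry_mass (T -` A \<inter> {0..<1}) = parry_mass A"
proof -
  let ?c = "\<lambda>n. measure lborel (A \<inter> {0..<(T ^^ n) 1}) / \<beta> ^ n"
  have "measure lborel (T -` A \<inter> {0..<1} \<inter> {0..<(T ^^ n) 1}) / \<beta> ^ n =
    measure lborel A * (of_int \<lfloor>\<beta> * (T ^^ n) 1\<rfloor> / \<beta> ^ Suc n) + ?c (Suc n)" for n
  proof -
    have "T -` A \<inter> {0..<1} \<inter> {0..<(T ^^ n) 1} = {0..<(T ^^ n) 1} \<inter> T -` A"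
      using orbit_one_range[of n] by auto
    then show ?thesis
      using measure_beta_map_vimage[OF A A_unit, of "(T ^^ n) 1"] orbit_one_range[of n] beta_gt_1
      by (simp add: field_simps)
  qed
  moreover have "(\<lambda>n. measure lborel A * (of_int \<lfloor>\<beta> * (T ^^ n) 1\<rfloor> / \<beta> ^ Suc n) + ?c (Suc n))
      sums (measure lborel A * 1 + (parry_mass A - ?c 0))"
    unfolding parry_mass_def
    by (intro sums_add sums_mult sums_digits_one sums_iff_shift[THEN iffD2] )
      (use summable_sums[OF summable_parry_mass] sums_Suc_iff[of ?c] in simp)
  moreover have "A \<inter> {0..<1} = A" using A_unit by auto
  ultimately show ?thesis unfolding parry_mass_def[of "T -` _ \<inter> _"] by (simp add: sums_iff)
qed

lemma nn_integral_parry_density: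
  "(\<integral>\<^sup>+x. parry_density x * indicator A x \<partial>lborel) = ennreal (parry_mass A)"
proof -
  have "(\<integral>\<^sup>+x. parry_density x * indicator A x \<partial>lborel) =
      (\<integral>\<^sup>+x. (\<Sum>n. ennreal (1 / \<beta> ^ n) * indicator (A \<inter> {0..<(T ^^ n) 1}) x) \<partial>lborel)"
    unfolding parry_density_def
    by (intro nn_integral_cong) (simp add: indicator_def)
  also have "\<dots> = (\<Sum>n. ennreal (1 / \<beta> ^ n) * emeasure lborel (A \<inter> {0..<(T ^^ n) 1}))"
    by (subst nn_integral_suminf) (simp_all add: nn_integral_cmult_indicator)
  also have "\<dots> = (\<Sum>n. ennreal (measure lborel (A \<inter> {0..<(T ^^ n) 1}) / \<beta> ^ n))"
  proof (rule suminf_cong)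
    fix n
    have "A \<inter> {0..<(T ^^ n) 1} \<in> fmeasurable lborel"
      using A_unit by (intro fmeasurable_subset_unit) auto
    then show "ennreal (1 / \<beta> ^ n) * emeasure lborel (A \<inter> {0..<(T ^^ n) 1}) =
        ennreal (measure lborel (A \<inter> {0..<(T ^^ n) 1}) / \<beta> ^ n)"
      using beta_gt_1 by (simp add: emeasure_eq_measure2 ennreal_mult[symmetric])
  qed
  also have "\<dots> = ennreal (parry_mass A)"
    unfolding parry_mass_def using beta_gt_1 by (intro suminf_ennreal2 summable_parry_mass) simp
  finally show ?thesis .
qed

end

lemma parry_measure_exists: "\<exists>M. is_parry_measure \<beta> M"
proof -
  let ?L = "restrict_space lborel {0..<1::real}"
  define c where "c = parry_mass {0..<1}"
  define M where "M = scale_measure (ennreal (1 / c)) (density ?L parry_density)"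
  have "1 \<le> c" unfolding c_def using parry_mass_ge[of "{0..<1}"] by simp
  have sets_iff: "A \<in> sets M \<longleftrightarrow> A \<in> sets borel \<and> A \<subseteq> {0..<1}" for A
    unfolding M_def by (auto simp: sets_restrict_space_iff)
  have sets_M: "sets M = sets (restrict_space borel {0..<1})"
    using sets_iff by (auto simp: sets_restrict_space_iff)
  have space_M: "space M = {0..<1}"
    using sets_eq_imp_space_eq[OF sets_M] by (simp add: space_restrict_space)
  have [measurable]: "parry_density \<in> borel_measurable borel"
    unfolding parry_density_def[abs_def] by measurable
  have emeasure_M: "emeasure M A = ennreal (parry_mass A / c)" if "A \<in> sets M" for A
  proof -
    have A [measurable]: "A \<in> sets borel" "A \<subseteq> {0..<1}" using that sets_iff by auto
    have "emeasure (density ?L parry_density) A = (\<integral>\<^sup>+x. parry_density x * indicator A x \<partial>?L)"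
      using A by (intro emeasure_density) (auto simp: sets_restrict_space_iff measurable_restrict_space1)
    also have "\<dots> = (\<integral>\<^sup>+x. parry_density x * indicator A x \<partial>lborel)"
      using A by (subst nn_integral_restrict_space)
        (auto intro!: nn_integral_cong simp: indicator_def)
    also have "\<dots> = ennreal (parry_mass A)" using A by (rule nn_integral_parry_density)
    finally have "emeasure M A = ennreal (1 / c) * ennreal (parry_mass A)"
      unfolding M_def by simp
    also have "0 \<le> parry_mass A"
      using parry_mass_ge[OF A] measure_nonneg[of lborel A] by linarith
    then have "ennreal (1 / c) * ennreal (parry_mass A) = ennreal (1 / c * parry_mass A)"
      using \<open>1 \<le> c\<close> by (intro ennreal_mult[symmetric]) simp_all
    finally show ?thesis by simp
  qed
  have mass_0: "parry_mass A = 0 \<longleftrightarrow> measure lborel A = 0" if "A \<in> sets M" for A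
  proof -
    have A: "A \<in> sets borel" "A \<subseteq> {0..<1}" using that by (auto simp: sets_iff)
    show ?thesis
      using parry_mass_ge[OF A] parry_mass_le[OF A] by (auto intro: antisym measure_nonneg)
  qed
  have null_iff: "emeasure M A = 0 \<longleftrightarrow> measure lborel A = 0" if "A \<in> sets M" for A
  proof -
    have "A \<in> sets borel" "A \<subseteq> {0..<1}" using that by (auto simp: sets_iff)
    then have "0 \<le> parry_mass A" using parry_mass_ge[of A] measure_nonneg[of lborel A] by linarith
    then have "emeasure M A = 0 \<longleftrightarrow> parry_mass A = 0"
      using \<open>1 \<le> c\<close> unfolding emeasure_M[OF that] ennreal_eq_0_iff by (auto simp: divide_le_0_iff)
    then show ?thesis using mass_0[OF that] by simp
  qed
  have Tm: "T \<in> measurable M M"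
  proof -
    have "T \<in> measurable (restrict_space borel {0..<1}) (restrict_space borel {0..<1})"
      by (intro measurable_restrict_space3) auto
    then show ?thesis using sets_M by (simp cong: measurable_cong_sets)
  qed
  have "is_parry_measure \<beta> M"
    unfolding is_parry_measure_def
  proof (intro conjI)
    show "sets M = sets (restrict_space borel {0..<1})" by (rule sets_M)
    have "{0..<1} \<in> sets M" by (simp add: sets_iff)
    then show "prob_space M"
      using \<open>1 \<le> c\<close> by (intro prob_spaceI) (simp add: space_M emeasure_M c_def[symmetric])
    show "invariant_measure T M"
      unfolding invariant_measure_def
    proof (intro conjI ballI Tm)
      fix A assume A: "A \<in> sets M"
      then have "T -` A \<inter> space M \<in> sets M" using Tm by (rule measurable_sets[rotated])
      then show "emeasure M (T -` A \<inter> space M) = emeasure M A"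
        using A parry_mass_vimage[of A] by (simp add: emeasure_M sets_iff space_M)
    qed
    show "ergodic_measure T M"
      unfolding ergodic_measure_def
    proof (intro ballI impI)
      fix A assume A: "A \<in> sets M" and inv: "T -` A \<inter> space M = A"
      have A': "A \<in> sets borel" "A \<subseteq> {0..<1}" using A by (auto simp: sets_iff)
      have "measure lborel ({0..<1} - A) = measure lborel {0..<1::real} - measure lborel A"
        using A' by (intro measurable_measure_Diff fmeasurable_subset_unit) auto
      moreover have "measure lborel A = 0 \<or> measure lborel A = 1"
        using invariant_set_trivial[OF A'] inv by (simp add: space_M)
      moreover have "space M - A \<in> sets M" using A by auto
      ultimately show "emeasure M A = 0 \<or> emeasure M (space M - A) = 0"
        using null_iff[OF A] null_iff[of "space M - A"] by (auto simp: space_M)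
    qed
    show "null_sets M = null_sets ?L"
    proof (rule set_eqI)
      fix A
      have "emeasure ?L A = ennreal (measure lborel A)" if "A \<in> sets M"
        using that fmeasurable_subset_unit[of A]
        by (subst emeasure_restrict_space) (auto simp: sets_iff emeasure_eq_measure2)
      moreover have "A \<in> sets ?L \<longleftrightarrow> A \<in> sets M" by (auto simp: sets_iff sets_restrict_space_iff)
      ultimately show "A \<in> null_sets M \<longleftrightarrow> A \<in> null_sets ?L"
        unfolding null_sets_def using null_iff[of A] by (auto simp: ennreal_eq_0_iff measure_le_0_iff)
    qed
  qed
  then show ?thesis ..
qed

lemma is_parry_measure: "is_parry_measure \<beta> (parry_measure \<beta>)"
  unfolding parry_measure_def using parry_measure_exists parry_measure_unique by (metis theI)

end

section \<open>Normality in terms of moments\<close>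

lemma birkhoff_sum_abs_diff_le:
  assumes "\<And>i. i < n \<Longrightarrow> \<bar>f ((T ^^ i) x) - g ((T ^^ i) x)\<bar> \<le> e"
  shows "\<bar>birkhoff_sum T f n x - birkhoff_sum T g n x\<bar> \<le> real n * e"
proof -
  have "\<bar>birkhoff_sum T f n x - birkhoff_sum T g n x\<bar> \<le> (\<Sum>i<n. \<bar>f ((T ^^ i) x) - g ((T ^^ i) x)\<bar>)"
    unfolding birkhoff_sum_def sum_subtractf[symmetric] by (rule sum_abs)
  also have "\<dots> \<le> real (card {..<n}) * e" using assms by (intro sum_bounded_above) simp
  finally show ?thesis by simp
qed

text \<open>Using \<open>n + 1\<close> orbit points makes this a probability measure for every
  \<open>n\<close>, so that the theory of weak convergence applies.\<close>

definition empirical_measure :: "('a \<Rightarrow> 'a) \<Rightarrow> ('a \<Rightarrow> real) \<Rightarrow> 'a \<Rightarrow> nat \<Rightarrow> real measure" where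
  "empirical_measure T f x n = distr (measure_pmf (pmf_of_set {..<Suc n})) borel (\<lambda>i. f ((T ^^ i) x))"

lemma real_distribution_empirical_measure: "real_distribution (empirical_measure T f x n)"
  unfolding empirical_measure_def by (intro prob_space.real_distribution_distr measure_pmf.prob_space_axioms) simp

lemma integral_empirical_measure:
  assumes [measurable]: "g \<in> borel_measurable borel"
  shows "(\<integral>t. g t \<partial>empirical_measure T f x n) = birkhoff_sum T (g \<circ> f) (Suc n) x / real (Suc n)"
  unfolding empirical_measure_def birkhoff_sum_def
  by (subst integral_distr) (auto simp: integral_pmf_of_set lessThan_empty_iff simp del: sum.lessThan_Suc)

lemma measure_empirical_measure:
  assumes [measurable]: "A \<in> sets borel"
  shows "measure (empirical_measure T f x n) A =
    real (card {i. i < Suc n \<and> f ((T ^^ i) x) \<in> A}) / real (Suc n)"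
proof -
  have "{..<Suc n} \<inter> (\<lambda>i. f ((T ^^ i) x)) -` A = {i. i < Suc n \<and> f ((T ^^ i) x) \<in> A}" by auto
  then show ?thesis
    unfolding empirical_measure_def
    by (subst measure_distr) (auto simp: measure_pmf_of_set lessThan_empty_iff)
qed

context beta_expansion
begin

abbreviation "\<mu> \<equiv> parry_measure \<beta>"

lemma parry_measure_facts:
  "sets \<mu> = sets (restrict_space borel {0..<1})" "prob_space \<mu>" "invariant_measure T \<mu>"
  "ergodic_measure T \<mu>" "null_sets \<mu> = null_sets (restrict_space lborel {0..<1})"
  using is_parry_measure by (simp_all add: is_parry_measure_def)

lemma space_parry_measure: "space \<mu> = {0..<1}"
  using sets_eq_imp_space_eq[OF parry_measure_facts(1)] by (simp add: space_restrict_space)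

lemma borel_measurable_parry:
  assumes "f \<in> borel_measurable borel"
  shows "f \<in> borel_measurable \<mu>"
  using measurable_restrict_space1[OF assms, of "{0..<1}"] parry_measure_facts(1)
  by (simp cong: measurable_cong_sets)

lemma orbit_range:
  assumes "x \<in> {0..<1}"
  shows "(T ^^ n) x \<in> {0..<1}"
  using assms by (cases n) auto

text \<open>Both sides express weak convergence of the empirical measures to \<open>\<mu>\<close>,
  viewed on the real line as \<open>\<nu>\<close>. Intervals yield the distribution functions;
  conversely, the frontier of an interval is Lebesgue null, hence null for \<open>\<mu>\<close>, so
  weak convergence reaches the interval itself.\<close>

lemma beta_normal_iff_moments:
  assumes x: "x \<in> {0..<1}"
  shows "beta_normal \<beta> x \<longleftrightarrow>
    (\<forall>k. (\<lambda>N. birkhoff_sum T (\<lambda>t. t ^ k) N x / real N) \<longlonglongrightarrow> (\<integral>t. t ^ k \<partial>\<mu>))"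
    (is "_ \<longleftrightarrow> ?moments")
proof -
  interpret mu: prob_space \<mu> by (rule parry_measure_facts)
  define \<nu> where "\<nu> = distr \<mu> borel (\<lambda>t. t)"
  let ?E = "empirical_measure T (\<lambda>t. t) x"
  have id_m [measurable]: "(\<lambda>t. t) \<in> borel_measurable \<mu>" by (rule borel_measurable_parry) simp
  have nu: "real_distribution \<nu>" unfolding \<nu>_def by (rule mu.real_distribution_distr) measurable
  have E: "real_distribution (?E n)" for n by (rule real_distribution_empirical_measure)
  have nu_measure: "measure \<nu> A = measure \<mu> (A \<inter> {0..<1})" if [measurable]: "A \<in> sets borel" for A
    unfolding \<nu>_def by (subst measure_distr) (auto simp: space_parry_measure)
  have nu_integral: "(\<integral>t. f t \<partial>\<nu>) = (\<integral>t. f t \<partial>\<mu>)" if "f \<in> borel_measurable borel" for f :: "real \<Rightarrow> real"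
    unfolding \<nu>_def using that by (subst integral_distr) auto
  have shift: "(\<lambda>n. f (Suc n)) \<longlonglongrightarrow> l \<longleftrightarrow> f \<longlonglongrightarrow> l" for f :: "nat \<Rightarrow> real" and l
    by (rule filterlim_sequentially_Suc)
  have normal_if: "beta_normal \<beta> x" if conv: "weak_conv_m ?E \<nu>"
    unfolding beta_normal_def
  proof (intro allI impI)
    fix I :: "real set"
    assume I: "is_interval I \<and> I \<subseteq> {0..<1}"
    then have cvx: "convex I" by (simp add: is_interval_convex)
    have [measurable]: "I \<in> sets borel" using I by (intro real_interval_borel_measurable) simp
    have "frontier I \<in> null_sets lebesgue"
      using negligible_convex_frontier[OF cvx] by (simp add: negligible_iff_null_sets)
    then have "frontier I \<in> null_sets lborel" by (simp add: null_sets_completion_iff frontier_closed)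
    then have "emeasure lborel (frontier I \<inter> {0..<1}) = 0"
      using emeasure_mono[of "frontier I \<inter> {0..<1}" "frontier I" lborel] by auto
    then have "frontier I \<inter> {0..<1} \<in> null_sets \<mu>"
      unfolding parry_measure_facts(5)
      by (auto simp: null_sets_def sets_restrict_space_iff emeasure_restrict_space)
    then have "measure \<nu> (frontier I) = 0"
      by (subst nu_measure) (auto intro: measure_eq_0_null_sets)
    then have "emeasure \<nu> (frontier I) = 0"
      by (simp add: finite_measure.emeasure_eq_measure prob_space.finite_measure[OF real_distribution.axioms(1)[OF nu]])
    then have "(\<lambda>n. measure (?E n) I) \<longlonglongrightarrow> measure \<nu> I"
      by (intro weak_conv_imp_continuity_set_conv[OF E nu conv]) auto
    moreover have "I \<inter> {0..<1} = I" using I by auto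
    ultimately show "(\<lambda>N. real (card {n. n < N \<and> (T ^^ n) x \<in> I}) / real N) \<longlonglongrightarrow> measure \<mu> I"
      by (subst shift[symmetric]) (simp add: measure_empirical_measure nu_measure)
  qed
  have normal_only_if: "weak_conv_m ?E \<nu>" if normal: "beta_normal \<beta> x"
    unfolding weak_conv_m_def weak_conv_def
  proof (intro allI impI)
    fix t :: real
    let ?I = "{..t} \<inter> {0..<1}"
    have "is_interval ?I" by (intro is_interval_Int) simp_all
    then have "(\<lambda>N. real (card {n. n < N \<and> (T ^^ n) x \<in> ?I}) / real N) \<longlonglongrightarrow> measure \<mu> ?I"
      using normal unfolding beta_normal_def by blast
    moreover have "{n. n < N \<and> (T ^^ n) x \<in> ?I} = {n. n < N \<and> (T ^^ n) x \<in> {..t}}" for N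
      using orbit_range[OF x] by auto
    ultimately show "(\<lambda>n. cdf (?E n) t) \<longlonglongrightarrow> cdf \<nu> t"
      by (subst (asm) shift[symmetric]) (simp add: cdf_def measure_empirical_measure nu_measure)
  qed
  show ?thesis
  proof
    assume "beta_normal \<beta> x"
    then have conv: "weak_conv_m ?E \<nu>" by (rule normal_only_if)
    show ?moments
    proof
      fix k
      \<comment> \<open>Weak convergence tests bounded continuous functions on the whole line, so
        the power is truncated outside \<open>[0,1]\<close>.\<close>
      define f :: "real \<Rightarrow> real" where "f t = (max 0 (min 1 t)) ^ k" for t
      have f_eq: "f t = t ^ k" if "t \<in> {0..<1}" for t using that by (simp add: f_def)
      have cont: "isCont f t" for t unfolding f_def[abs_def] by (intro continuous_intros)
      then have [measurable]: "f \<in> borel_measurable borel"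
        by (intro borel_measurable_continuous_onI continuous_at_imp_continuous_on) simp
      have "(\<lambda>n. \<integral>t. f t \<partial>?E n) \<longlonglongrightarrow> (\<integral>t. f t \<partial>\<nu>)"
        by (rule weak_conv_imp_integral_bdd_continuous_conv[OF E nu conv cont, where B = 1])
          (simp add: f_def power_le_one)
      moreover have "(\<integral>t. f t \<partial>\<mu>) = (\<integral>t. t ^ k \<partial>\<mu>)"
        by (intro Bochner_Integration.integral_cong) (auto simp: space_parry_measure f_eq)
      moreover have "birkhoff_sum T f N x = birkhoff_sum T (\<lambda>t. t ^ k) N x" for N
        unfolding birkhoff_sum_def using orbit_range[OF x] by (intro sum.cong) (auto simp: f_eq)
      ultimately show "(\<lambda>N. birkhoff_sum T (\<lambda>t. t ^ k) N x / real N) \<longlonglongrightarrow> (\<integral>t. t ^ k \<partial>\<mu>)"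
        by (subst shift[symmetric]) (simp add: integral_empirical_measure nu_integral o_def)
    qed
  next
    assume moments: ?moments
    have "weak_conv_m ?E \<nu>"
    proof (rule integral_bdd_continuous_conv_imp_weak_conv[OF E nu])
      fix f :: "real \<Rightarrow> real"
      assume cont: "\<And>t. isCont f t" and bound: "\<And>t. \<bar>f t\<bar> \<le> 1"
      have [measurable]: "f \<in> borel_measurable borel"
        using cont by (intro borel_measurable_continuous_onI continuous_at_imp_continuous_on) simp
      have "(\<lambda>N. birkhoff_sum T f N x / real N) \<longlonglongrightarrow> (\<integral>t. f t \<partial>\<mu>)"
      proof (rule LIMSEQ_I)
        fix e :: real assume "e > 0"
        have "continuous_on {0..1} f" using cont by (intro continuous_at_imp_continuous_on) simp
        then obtain g where "real_polynomial_function g" and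
          fg: "\<And>t. t \<in> {0..1} \<Longrightarrow> \<bar>f t - g t\<bar> < e / 3"
          using Stone_Weierstrass_real_polynomial_function[of "{0..1}" f "e / 3"] \<open>e > 0\<close> by auto
        then obtain a d where g: "g = (\<lambda>t. \<Sum>i\<le>d. a i * t ^ i)"
          by (auto simp: real_polynomial_function_iff_sum)
        have int_pow: "integrable \<mu> (\<lambda>t. t ^ i)" for i :: nat
          by (rule mu.integrable_const_bound[where B = 1])
            (auto intro!: AE_I2 borel_measurable_parry power_le_one simp: space_parry_measure)
        have sum_g: "birkhoff_sum T g N x = (\<Sum>i\<le>d. a i * birkhoff_sum T (\<lambda>t. t ^ i) N x)" for N
          unfolding birkhoff_sum_def g sum_distrib_left by (rule sum.swap)
        have int_g: "integrable \<mu> g" "(\<integral>t. g t \<partial>\<mu>) = (\<Sum>i\<le>d. a i * (\<integral>t. t ^ i \<partial>\<mu>))"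
          unfolding g using int_pow by (simp_all add: integral_sum)
        have "(\<lambda>N. \<Sum>i\<le>d. a i * (birkhoff_sum T (\<lambda>t. t ^ i) N x / real N)) \<longlonglongrightarrow> (\<integral>t. g t \<partial>\<mu>)"
          unfolding int_g by (intro tendsto_intros moments[rule_format])
        then have "(\<lambda>N. birkhoff_sum T g N x / real N) \<longlonglongrightarrow> (\<integral>t. g t \<partial>\<mu>)"
          unfolding sum_g by (simp add: sum_divide_distrib)
        then obtain N0 where N0: "\<And>N. N \<ge> N0 \<Longrightarrow>
            \<bar>birkhoff_sum T g N x / real N - (\<integral>t. g t \<partial>\<mu>)\<bar> < e / 3"
          using LIMSEQ_D[of _ _ "e / 3"] \<open>e > 0\<close> unfolding real_norm_def by force
        have int_f: "integrable \<mu> f"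
          using bound by (intro mu.integrable_const_bound[where B = 1] borel_measurable_parry) auto
        have "\<bar>(\<integral>t. f t \<partial>\<mu>) - (\<integral>t. g t \<partial>\<mu>)\<bar> = \<bar>\<integral>t. f t - g t \<partial>\<mu>\<bar>"
          using int_f int_g by simp
        also have "\<dots> \<le> (\<integral>t. \<bar>f t - g t\<bar> \<partial>\<mu>)" by (rule integral_abs_bound)
        also have "\<dots> \<le> (\<integral>t. e / 3 \<partial>\<mu>)"
          using int_f int_g fg
          by (intro integral_mono) (auto simp: space_parry_measure less_imp_le)
        finally have int_diff: "\<bar>(\<integral>t. f t \<partial>\<mu>) - (\<integral>t. g t \<partial>\<mu>)\<bar> \<le> e / 3"
          by (simp add: mu.prob_space)
        show "\<exists>N0. \<forall>N\<ge>N0. norm (birkhoff_sum T f N x / real N - (\<integral>t. f t \<partial>\<mu>)) < e"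
        proof (intro exI allI impI)
          fix N assume N: "N \<ge> max 1 N0"
          have "\<bar>birkhoff_sum T f N x - birkhoff_sum T g N x\<bar> \<le> real N * (e / 3)"
          proof (intro birkhoff_sum_abs_diff_le less_imp_le fg)
            show "(T ^^ i) x \<in> {0..1}" for i using orbit_range[OF x, of i] by simp
          qed
          then have "\<bar>(birkhoff_sum T f N x - birkhoff_sum T g N x) / real N\<bar> \<le> e / 3"
            using N by (simp add: abs_divide pos_divide_le_eq mult.commute)
          then have "\<bar>birkhoff_sum T f N x / real N - birkhoff_sum T g N x / real N\<bar> \<le> e / 3"
            by (simp add: diff_divide_distrib)
          moreover have "\<bar>birkhoff_sum T g N x / real N - (\<integral>t. g t \<partial>\<mu>)\<bar> < e / 3"
            using N by (intro N0) simp
          ultimately show "norm (birkhoff_sum T f N x / real N - (\<integral>t. f t \<partial>\<mu>)) < e"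
            using int_diff unfolding real_norm_def abs_le_iff abs_less_iff by linarith
        qed
      qed
      then show "(\<lambda>n. \<integral>t. f t \<partial>?E n) \<longlonglongrightarrow> (\<integral>t. f t \<partial>\<nu>)"
        by (subst (asm) shift[symmetric]) (simp add: integral_empirical_measure nu_integral o_def)
    qed
    then show "beta_normal \<beta> x" by (rule normal_if)
  qed
qed

lemma beta_normal_exists: "\<exists>y\<in>{0..<1}. beta_normal \<beta> y"
proof -
  interpret mu: prob_space \<mu> by (rule parry_measure_facts)
  have "AE x in \<mu>. \<forall>k. (\<lambda>N. birkhoff_sum T (\<lambda>t. t ^ k) N x / real N) \<longlonglongrightarrow> (\<integral>t. t ^ k \<partial>\<mu>)"
    unfolding AE_all_countable
    by (intro allI birkhoff_ergodic[where B = 1] parry_measure_facts borel_measurable_parry)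
      (auto simp: space_parry_measure power_le_one)
  then have "AE x in \<mu>. beta_normal \<beta> x"
    by (rule AE_mp) (auto intro!: AE_I2 simp: space_parry_measure beta_normal_iff_moments)
  then have "AE x in \<mu>. x \<in> {0..<1} \<and> beta_normal \<beta> x"
    using AE_space by eventually_elim (simp add: space_parry_measure)
  then show ?thesis
    using eventually_happens[of _ "ae_filter \<mu>"] mu.ae_filter_bot by blast
qed

text \<open>Since \<open>{0}\<close> is null, the first moment distinguishes \<open>\<mu>\<close>
  from the point mass at the fixed point \<open>0\<close>. This excludes finite expansions from
  normality and detects long runs of zeros.\<close>

lemma parry_mean_pos: "0 < (\<integral>t. t \<partial>\<mu>)"
proof -
  interpret mu: prob_space \<mu> by (rule parry_measure_facts)
  have int: "integrable \<mu> (\<lambda>t. t)"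
    by (rule mu.integrable_const_bound[where B = 1])
      (auto intro!: AE_I2 borel_measurable_parry simp: space_parry_measure)
  have "{0} \<in> null_sets \<mu>"
    unfolding parry_measure_facts(5) by (auto simp: null_sets_def sets_restrict_space_iff emeasure_restrict_space)
  then have "AE t in \<mu>. 0 < t"
    by (rule AE_I') (auto simp: space_parry_measure)
  moreover have "\<not> (AE t in \<mu>. t = 0)"
  proof
    assume "AE t in \<mu>. t = 0"
    moreover have "AE t in \<mu>. t \<noteq> 0"
      using \<open>AE t in \<mu>. 0 < t\<close> by eventually_elim simp
    ultimately show False by (rule mu.AE_contr)
  qed
  moreover have "0 \<le> (\<integral>t. t \<partial>\<mu>)"
    by (intro Bochner_Integration.integral_nonneg_AE AE_I2) (auto simp: space_parry_measure)
  moreover have "(\<integral>t. t \<partial>\<mu>) = 0 \<longleftrightarrow> (AE t in \<mu>. t = 0)"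
    by (rule integral_nonneg_eq_0_iff_AE[OF int]) (auto intro!: AE_I2 simp: space_parry_measure)
  ultimately show ?thesis by auto
qed

end

section \<open>The upper bound in the Borel hierarchy\<close>

lemma Pi0_in_3I:
  fixes F :: "'i :: countable \<Rightarrow> nat \<Rightarrow> 'a set"
  assumes closed: "\<And>i m. closedin X (F i m)"
    and S: "S = topspace X \<inter> (\<Inter>i. \<Union>m. F i m)"
  shows "Pi0_in X 3 S"
proof -
  have "Pi0_in X 1 (F i m)" for i m
    using Pi0_compl[OF Sigma0_open[OF openin_diff[OF openin_topspace closed[of i m]]]]
      closedin_subset[OF closed[of i m]] by (simp add: double_diff)
  then have "Sigma0_in X 2 (\<Union>m. F i m)" for i
    using Sigma0_Union[of X 1 "F i"] by (simp add: numeral_2_eq_2)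
  then have "Pi0_in X 2 (topspace X - (\<Union>m. F i m))" for i by (rule Pi0_compl)
  then have "Sigma0_in X 3 (\<Union>n::nat. topspace X - (\<Union>m. F (from_nat n) m))"
    using Sigma0_Union[of X 2 "\<lambda>n. topspace X - (\<Union>m. F (from_nat n) m)"] by (simp add: numeral_3_eq_3)
  then have "Pi0_in X 3 (topspace X - (\<Union>n::nat. topspace X - (\<Union>m. F (from_nat n) m)))"
    by (rule Pi0_compl)
  also have "topspace X - (\<Union>n::nat. topspace X - (\<Union>m. F (from_nat n) m)) = S"
  proof -
    have "(\<Inter>i. \<Union>m. F i m) = (\<Inter>n::nat. \<Union>m. F (from_nat n) m)"
    proof (intro subset_antisym INF_greatest)
      fix i :: 'i
      have "(\<Inter>n::nat. \<Union>m. F (from_nat n) m) \<subseteq> (\<Union>m. F (from_nat (to_nat i)) m)" by (rule INF_lower) simp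
      then show "(\<Inter>n::nat. \<Union>m. F (from_nat n) m) \<subseteq> (\<Union>m. F i m)" by simp
    qed (rule INF_lower, simp)
    then show ?thesis unfolding S by auto
  qed
  finally show ?thesis .
qed

section \<open>Inversion of the Borel hierarchy\<close>

lemma Sigma0_in_0: "\<not> Sigma0_in X 0 S" and Pi0_in_0: "\<not> Pi0_in X 0 S"
proof -
  show *: "\<not> Sigma0_in X 0 S" for S
  proof
    assume "Sigma0_in X 0 S"
    then show False by (cases rule: Sigma0_in.cases) simp_all
  qed
  show "\<not> Pi0_in X 0 S"
  proof
    assume "Pi0_in X 0 S"
    then show False by (cases rule: Pi0_in.cases) (simp add: *)
  qed
qed

text \<open>The union rule could reach level 1 only from level 0, which is empty.\<close>

lemma Sigma0_in_1_open: "Sigma0_in X (Suc 0) S \<Longrightarrow> openin X S"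
  by (erule Sigma0_in.cases) (auto simp: Pi0_in_0)

lemma Sigma0_in_SucD:
  assumes "Sigma0_in X (Suc (Suc k)) S"
  obtains A where "\<And>n::nat. Sigma0_in X (Suc k) (A n)" "S = (\<Union>n. topspace X - A n)"
proof -
  obtain B where B: "\<And>n::nat. Pi0_in X (Suc k) (B n)" "S = (\<Union>n. B n)"
    using assms by (cases rule: Sigma0_in.cases) auto
  have "\<forall>n. \<exists>A. Sigma0_in X (Suc k) A \<and> B n = topspace X - A"
  proof
    fix n
    show "\<exists>A. Sigma0_in X (Suc k) A \<and> B n = topspace X - A"
      using B(1)[of n] by (cases rule: Pi0_in.cases) auto
  qed
  then obtain A where "\<And>n. Sigma0_in X (Suc k) (A n) \<and> B n = topspace X - A n" by metis
  with B(2) show thesis by (intro that[of A]) simp_all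
qed

lemma Sigma0_in_3D:
  assumes "Sigma0_in X 3 S"
  obtains U :: "nat \<Rightarrow> nat \<Rightarrow> 'a set"
  where "\<And>i j. openin X (U i j)" "S = (\<Union>i. topspace X \<inter> (\<Inter>j. U i j))"
proof -
  have "Sigma0_in X (Suc (Suc 1)) S" using assms by (simp add: numeral_3_eq_3)
  then obtain A where A: "\<And>n::nat. Sigma0_in X (Suc 1) (A n)" "S = (\<Union>n. topspace X - A n)"
    by (rule Sigma0_in_SucD) blast
  have "\<exists>U. (\<forall>j::nat. openin X (U j)) \<and> A i = (\<Union>j. topspace X - U j)" for i
  proof -
    have "Sigma0_in X (Suc (Suc 0)) (A i)" using A(1)[of i] by simp
    then obtain U where "\<And>j::nat. Sigma0_in X (Suc 0) (U j)" "A i = (\<Union>j. topspace X - U j)"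
      by (rule Sigma0_in_SucD) blast
    then show ?thesis by (intro exI[of _ U]) (simp add: Sigma0_in_1_open)
  qed
  then obtain U where U: "\<And>i j::nat. openin X (U i j)" "\<And>i. A i = (\<Union>j. topspace X - U i j)"
    by metis
  show thesis
  proof (rule that[of U])
    show "S = (\<Union>i. topspace X \<inter> (\<Inter>j. U i j))" unfolding A(2) U(2) by blast
  qed (rule U(1))
qed

text \<open>Countably many tolerances and non-strict inequalities are what turns convergence into a
  countable intersection of countable unions of closed conditions.\<close>

lemma LIMSEQ_iff_Suc:
  fixes f :: "nat \<Rightarrow> real"
  shows "f \<longlonglongrightarrow> l \<longleftrightarrow> (\<forall>j::nat. \<exists>M. \<forall>N\<ge>M. \<bar>f N - l\<bar> \<le> 1 / real (Suc j))"
proof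
  assume f: "f \<longlonglongrightarrow> l"
  show "\<forall>j::nat. \<exists>M. \<forall>N\<ge>M. \<bar>f N - l\<bar> \<le> 1 / real (Suc j)"
  proof
    fix j :: nat
    show "\<exists>M. \<forall>N\<ge>M. \<bar>f N - l\<bar> \<le> 1 / real (Suc j)"
      using LIMSEQ_D[OF f, of "1 / real (Suc j)"] by (auto intro: less_imp_le)
  qed
next
  assume *: "\<forall>j::nat. \<exists>M. \<forall>N\<ge>M. \<bar>f N - l\<bar> \<le> 1 / real (Suc j)"
  show "f \<longlonglongrightarrow> l"
  proof (rule LIMSEQ_I)
    fix e :: real assume "e > 0"
    then obtain j :: nat where "1 / real (Suc j) < e" by (rule nat_approx_posE)
    moreover obtain M where "\<forall>N\<ge>M. \<bar>f N - l\<bar> \<le> 1 / real (Suc j)" using * by blast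
    ultimately show "\<exists>M. \<forall>N\<ge>M. norm (f N - l) < e"
      by (intro exI[of _ M] allI impI) (unfold real_norm_def, erule allE, drule (1) mp, rule le_less_trans)
  qed
qed

context beta_expansion
begin

text \<open>Within \<open>[0,1)\<close> this contains every discontinuity of every iterate:
  \<open>T\<close> jumps only where \<open>\<beta> * x\<close> is an integer, that is, where
  \<open>T x = 0\<close>.\<close>

definition finite_expansions :: "real set" where
  "finite_expansions = {x \<in> {0..<1}. \<exists>n. (T ^^ n) x = 0}"

lemma countable_finite_expansions: "countable finite_expansions"
proof -
  have "countable {x \<in> {0..<1}. (T ^^ n) x = 0}" for n
  proof (induction n)
    case 0
    have "{x \<in> {0..<1::real}. (T ^^ 0) x = 0} = {0}" by auto
    then show ?case by simp
  next
    case (Suc n)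
    let ?C = "{x \<in> {0..<1}. (T ^^ n) x = 0}"
    have "{x \<in> {0..<1}. (T ^^ Suc n) x = 0} \<subseteq> (\<lambda>(c, k :: int). (c + of_int k) / \<beta>) ` (?C \<times> UNIV)"
    proof
      fix x assume "x \<in> {x \<in> {0..<1}. (T ^^ Suc n) x = 0}"
      then have "T x \<in> ?C" by (simp add: funpow_swap1)
      moreover have "x = (T x + of_int \<lfloor>\<beta> * x\<rfloor>) / \<beta>"
        using beta_gt_1 by (simp add: beta_map_def frac_def)
      ultimately show "x \<in> (\<lambda>(c, k :: int). (c + of_int k) / \<beta>) ` (?C \<times> UNIV)" by force
    qed
    then show ?case by (rule countable_subset) (intro countable_image countable_SIGMA Suc, auto)
  qed
  moreover have "finite_expansions = (\<Union>n. {x \<in> {0..<1}. (T ^^ n) x = 0})"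
    unfolding finite_expansions_def by auto
  ultimately show ?thesis by simp
qed

lemma beta_map_0 [simp]: "T 0 = 0"
  by (simp add: beta_map_def)

text \<open>The orbit ends in the fixed point \<open>0\<close>, so its averages tend to
  \<open>0\<close>, whereas the mean of \<open>\<mu>\<close> is positive.\<close>

lemma not_normal_finite_expansion:
  assumes "x \<in> finite_expansions"
  shows "\<not> beta_normal \<beta> x"
proof
  assume normal: "beta_normal \<beta> x"
  from assms obtain n where x: "x \<in> {0..<1}" and n: "(T ^^ n) x = 0"
    by (auto simp: finite_expansions_def)
  have "(T ^^ i) 0 = 0" for i by (induction i) auto
  then have "birkhoff_sum T (\<lambda>t. t ^ 1) (n + N) x = birkhoff_sum T (\<lambda>t. t ^ 1) n x" for N
    unfolding birkhoff_sum_add n by (simp add: birkhoff_sum_def)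
  moreover have "(\<lambda>N. birkhoff_sum T (\<lambda>t. t ^ 1) N x / real N) \<longlonglongrightarrow> (\<integral>t. t ^ 1 \<partial>\<mu>)"
    using normal beta_normal_iff_moments[OF x] by blast
  then have "(\<lambda>N. birkhoff_sum T (\<lambda>t. t ^ 1) (n + N) x / real (n + N)) \<longlonglongrightarrow> (\<integral>t. t ^ 1 \<partial>\<mu>)"
    by (subst add.commute, subst add.commute) (rule LIMSEQ_ignore_initial_segment)
  ultimately have "(\<lambda>N. birkhoff_sum T (\<lambda>t. t ^ 1) n x / real (n + N)) \<longlonglongrightarrow> (\<integral>t. t \<partial>\<mu>)"
    by simp
  moreover have "(\<lambda>N. birkhoff_sum T (\<lambda>t. t ^ 1) n x / real (n + N)) \<longlonglongrightarrow> 0"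
    by (rule real_tendsto_divide_at_top[OF tendsto_const])
      (rule filterlim_compose[OF filterlim_real_sequentially filterlim_add_const_nat_at_top[of n, unfolded add.commute[of _ n]]])
  ultimately show False using parry_mean_pos LIMSEQ_unique by fastforce
qed

lemma isCont_orbit:
  assumes "x \<in> {0..<1}" "x \<notin> finite_expansions"
  shows "isCont (T ^^ n) x"
proof (induction n)
  case (Suc n)
  have "(T ^^ Suc n) x \<noteq> 0" using assms unfolding finite_expansions_def by blast
  then have "\<beta> * (T ^^ n) x \<notin> \<int>" by (simp add: beta_map_def frac_eq_0_iff)
  then have "isCont frac (\<beta> * (T ^^ n) x)" by (rule continuous_frac)
  moreover have "isCont (\<lambda>y. \<beta> * y) ((T ^^ n) x)" by (intro continuous_intros)
  ultimately have "isCont (\<lambda>y. frac (\<beta> * y)) ((T ^^ n) x)"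
    using isCont_o2[of "(T ^^ n) x" "\<lambda>y. \<beta> * y" frac] by blast
  then have "isCont T ((T ^^ n) x)" unfolding beta_map_def[abs_def] .
  with Suc have "isCont (\<lambda>x. T ((T ^^ n) x)) x" by (rule isCont_o2)
  then show ?case by (simp add: o_def)
qed (simp add: id_def)

text \<open>Off the countable set of finite expansions all iterates of \<open>T\<close> are continuous, so there the
  condition that all averages of length at least \<open>M\<close> are close to their limit is relatively closed.
  Taking closures in \<open>[0,1)\<close> costs nothing, since finite expansions are removed separately.\<close>

lemma normal_set_Pi03:
  "Pi0_in (top_of_set {0..<1}) 3 {x \<in> {0..<1}. beta_normal \<beta> x}"
proof -
  let ?avg = "\<lambda>k N x. birkhoff_sum T (\<lambda>t. t ^ k) N x / real N"
  let ?m = "\<lambda>k. \<integral>t. t ^ k \<partial>\<mu>"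
  define Q where "Q k j M = {x \<in> {0..<1} - finite_expansions. \<forall>N\<ge>M. \<bar>?avg k N x - ?m k\<bar> \<le> 1 / real (Suc j)}"
    for k j M
  have normal_iff: "beta_normal \<beta> x \<longleftrightarrow> (\<forall>k j. \<exists>M. x \<in> Q k j M)"
    if "x \<in> {0..<1} - finite_expansions" for x
    using that by (simp add: beta_normal_iff_moments LIMSEQ_iff_Suc Q_def)
  have Q_closed: "x \<in> Q k j M" if cl: "x \<in> closure (Q k j M)" and x: "x \<in> {0..<1} - finite_expansions" for x k j M
  proof -
    obtain a where a: "\<And>n. a n \<in> Q k j M" "a \<longlonglongrightarrow> x"
      using cl unfolding closure_sequential by blast
    have "\<bar>?avg k N x - ?m k\<bar> \<le> 1 / real (Suc j)" if "N \<ge> M" for N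
    proof (rule LIMSEQ_le_const2)
      have "isCont (\<lambda>x. \<bar>?avg k N x - ?m k\<bar>) x"
        unfolding birkhoff_sum_def divide_inverse
        using isCont_orbit[of x] x by (intro continuous_intros) auto
      then show "(\<lambda>n. \<bar>?avg k N (a n) - ?m k\<bar>) \<longlonglongrightarrow> \<bar>?avg k N x - ?m k\<bar>"
        using a(2) by (rule isCont_tendsto_compose)
      show "\<exists>n0. \<forall>n\<ge>n0. \<bar>?avg k N (a n) - ?m k\<bar> \<le> 1 / real (Suc j)"
        using a(1) that by (auto simp: Q_def)
    qed
    then show ?thesis using x by (simp add: Q_def)
  qed
  \<comment> \<open>The index \<open>Inl n\<close> removes the \<open>n\<close>-th finite expansion,
    the complement of a point being a countable union of closed sets; \<open>Inr (k, j)\<close>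
    controls the \<open>k\<close>-th moment up to \<open>1 / Suc j\<close>.\<close>
  define F :: "nat + nat \<times> nat \<Rightarrow> nat \<Rightarrow> real set" where
    "F i m = {0..<1} \<inter> (case i of
        Inl n \<Rightarrow> {x. 1 / real (Suc m) \<le> \<bar>x - from_nat_into finite_expansions n\<bar>}
      | Inr (k, j) \<Rightarrow> closure (Q k j m))" for i m
  \<comment> \<open>Nonemptiness ensures that \<open>from_nat_into\<close> enumerates exactly this
    set.\<close>
  have "0 \<in> finite_expansions" by (auto simp: finite_expansions_def intro!: exI[of _ 0])
  then have range: "range (from_nat_into finite_expansions) = finite_expansions"
    using countable_finite_expansions by (intro range_from_nat_into) auto
  show ?thesis
  proof (rule Pi0_in_3I[of _ F])
    show "closedin (top_of_set {0..<1}) (F i m)" for i m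
    proof -
      have "closed {x. 1 / real (Suc m) \<le> \<bar>x - c\<bar>}" for c :: real
        by (intro closed_Collect_le continuous_intros)
      then show ?thesis
        unfolding F_def by (intro closedin_closed_Int) (auto split: sum.split prod.split)
    qed
    have Inl_iff: "(\<exists>m. x \<in> F (Inl n) m) \<longleftrightarrow> x \<noteq> from_nat_into finite_expansions n" if "x \<in> {0..<1}" for x n
    proof
      assume "x \<noteq> from_nat_into finite_expansions n"
      then have "0 < \<bar>x - from_nat_into finite_expansions n\<bar>" by simp
      then obtain m :: nat where "1 / real (Suc m) < \<bar>x - from_nat_into finite_expansions n\<bar>"
        by (rule nat_approx_posE)
      then show "\<exists>m. x \<in> F (Inl n) m" using that by (intro exI[of _ m]) (simp add: F_def)
    qed (auto simp: F_def)
    have Inr_iff: "x \<in> F (Inr (k, j)) m \<longleftrightarrow> x \<in> Q k j m" if "x \<in> {0..<1} - finite_expansions" for x k j m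
      using Q_closed[of x k j m] closure_subset[of "Q k j m"] that by (auto simp: F_def)
    have "x \<in> {0..<1} \<and> beta_normal \<beta> x \<longleftrightarrow> x \<in> {0..<1} \<and> (\<forall>i. \<exists>m. x \<in> F i m)" for x
    proof (cases "x \<in> {0..<1} - finite_expansions")
      case True
      then have "\<forall>n. \<exists>m. x \<in> F (Inl n) m" using Inl_iff[of x] range by auto
      then show ?thesis
        using True normal_iff[OF True] Inr_iff[OF True] by (auto simp: split_sum_all)
    next
      case False
      then show ?thesis using not_normal_finite_expansion[of x] Inl_iff[of x] range by (metis DiffI rangeE)
    qed
    then show "{x \<in> {0..<1}. beta_normal \<beta> x} = topspace (top_of_set {0..<1}) \<inter> (\<Inter>i. \<Union>m. F i m)"
      by auto
  qed
qed

end

section \<open>Sequences tending to infinity\<close>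

lemma limit_of_stabilizing_sequences:
  fixes z :: "nat \<Rightarrow> nat \<Rightarrow> 'a"
  assumes agree: "\<And>j k. k < n j \<Longrightarrow> z (Suc j) k = z j k" and n: "\<And>j. n j < n (Suc j)"
  obtains w where "\<And>j k. k < n j \<Longrightarrow> w k = z j k"
proof
  fix j k assume k: "k < n j"
  have mono: "strict_mono n" using n by (simp add: strict_mono_Suc_iff)
  have le: "k < n (Suc k)" using strict_mono_imp_increasing[OF mono, of "Suc k"] by simp
  have stable: "z (i + d) k = z i k" if "k < n i" for i d
  proof (induction d)
    case (Suc d)
    have "n i \<le> n (i + d)" using mono by (simp add: strict_mono_less_eq)
    with that Suc show ?case using agree[of k "i + d"] by simp
  qed simp
  \<comment> \<open>The witness is the diagonal; entry \<open>k\<close> is already final at stage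
    \<open>Suc k\<close>, because a strictly increasing \<open>n\<close> satisfies
    \<open>k < n (Suc k)\<close>.\<close>
  show "z (Suc k) k = z j k"
  proof (cases "j \<le> Suc k")
    case True
    then show ?thesis using stable[OF k, of "Suc k - j"] by simp
  next
    case False
    then show ?thesis using stable[OF le, of "j - Suc k"] by simp
  qed
qed

text \<open>\<open>seq_cone z n m\<close> is the closed set of sequences that extend \<open>z 0, \<dots>, z (n - 1)\<close> by values at
  least \<open>m\<close>. Generic elements of it take the value \<open>m\<close> infinitely often, so by a Baire category
  argument a \<open>G\<^sub>\<delta>\<close> set of sequences tending to infinity misses a smaller cone with the same \<open>m\<close>.\<close>

definition seq_cone :: "(nat \<Rightarrow> nat) \<Rightarrow> nat \<Rightarrow> nat \<Rightarrow> (nat \<Rightarrow> nat) set" where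
  "seq_cone z n m = {w. (\<forall>k<n. w k = z k) \<and> (\<forall>k\<ge>n. m \<le> w k)}"

text \<open>Openness in the product topology of the Baire space of sequences.\<close>

definition finitely_determined :: "(nat \<Rightarrow> nat) set \<Rightarrow> bool" where
  "finitely_determined G \<longleftrightarrow> (\<forall>z\<in>G. \<exists>n. \<forall>w. (\<forall>k<n. w k = z k) \<longrightarrow> w \<in> G)"

lemma G_delta_avoids_cone:
  assumes G: "\<And>j :: nat. finitely_determined (G j)"
    and sub: "(\<Inter>j. G j) \<subseteq> {z. filterlim z at_top sequentially}"
  shows "\<exists>z' n'. n < n' \<and> z' \<in> seq_cone z n m \<and> seq_cone z' n' m \<inter> (\<Inter>j. G j) = {}"
proof (rule ccontr)
  assume neg: "\<not> ?thesis"
  have dense: "\<exists>w \<in> seq_cone z' n' m. w \<in> (\<Inter>j. G j)" if "z' \<in> seq_cone z n m" "n < n'" for z' n'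
    using neg that by blast
  let ?P = "\<lambda>s :: (nat \<Rightarrow> nat) \<times> nat. fst s \<in> seq_cone z n m \<and> n \<le> snd s"
  let ?Q = "\<lambda>j s s' :: (nat \<Rightarrow> nat) \<times> nat. snd s < snd s' \<and> (\<forall>k<snd s. fst s' k = fst s k) \<and>
    fst s' (snd s) = m \<and> (\<forall>w. (\<forall>k<snd s'. w k = fst s' k) \<longrightarrow> w \<in> G j)"
  have init: "\<exists>s. ?P s"
    by (intro exI[of _ "(\<lambda>k. if k < n then z k else m, n)"]) (simp add: seq_cone_def)
  have step: "\<exists>s'. ?P s' \<and> ?Q j s s'" if s: "?P s" for s j
  proof -
    \<comment> \<open>Filling up with \<open>m\<close> puts the value \<open>m\<close> at position
      \<open>snd s\<close>, and the cone starting at \<open>Suc (snd s)\<close> preserves it while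
      density provides a point of \<open>G j\<close>.\<close>
    define u where "u = (\<lambda>k. if k < snd s then fst s k else m)"
    have u: "u \<in> seq_cone z n m" using s by (auto simp: seq_cone_def u_def)
    have "n < Suc (snd s)" using s by simp
    from dense[OF u this] obtain w where w: "w \<in> seq_cone u (Suc (snd s)) m" "w \<in> (\<Inter>j. G j)"
      by blast
    from w(2) have "w \<in> G j" by blast
    then obtain l where l: "\<And>w'. (\<forall>k<l. w' k = w k) \<Longrightarrow> w' \<in> G j"
      using G[of j] unfolding finitely_determined_def by blast
    have wk: "w k = u k" if "k < Suc (snd s)" for k using w(1) that by (simp add: seq_cone_def)
    have "w \<in> seq_cone z n m"
      unfolding seq_cone_def
    proof (intro CollectI conjI allI impI)
      show "w k = z k" if "k < n" for k
        using wk[of k] u s that by (simp add: seq_cone_def)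
      show "m \<le> w k" if "n \<le> k" for k
        using wk[of k] u w(1) that by (cases "k < Suc (snd s)") (simp_all add: seq_cone_def)
    qed
    moreover have "\<forall>k<snd s. w k = fst s k" "w (snd s) = m" using wk by (auto simp: u_def)
    ultimately show ?thesis
      using s l by (intro exI[of _ "(w, max (Suc (snd s)) l)"]) auto
  qed
  obtain s where s: "\<forall>j. ?P (s j) \<and> ?Q j (s j) (s (Suc j))"
  proof -
    have "\<exists>s. \<forall>j. ?P (s j) \<and> ?Q j (s j) (s (Suc j))"
      by (rule dependent_nat_choice[of "\<lambda>_. ?P" ?Q]) (rule init, rule step)
    then show thesis using that by (elim exE)
  qed
  have s: "?Q j (s j) (s (Suc j))" for j using s[THEN spec, of j] by (rule conjunct2)
  obtain w where w: "\<And>j k. k < snd (s j) \<Longrightarrow> w k = fst (s j) k"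
  proof (rule limit_of_stabilizing_sequences)
    show "fst (s (Suc j)) k = fst (s j) k" if "k < snd (s j)" for j k
      using s[of j] that by simp
    show "snd (s j) < snd (s (Suc j))" for j using s[of j] by simp
  qed (rule that, blast)
  have "w \<in> G j" for j using s[of j] w[of _ "Suc j"] by blast
  then have "filterlim w at_top sequentially" using sub by blast
  then obtain K where K: "\<And>k. k \<ge> K \<Longrightarrow> Suc m \<le> w k"
    unfolding filterlim_at_top eventually_sequentially by blast
  have "strict_mono (\<lambda>j. snd (s j))" using s by (simp add: strict_mono_Suc_iff)
  then have "K \<le> snd (s K)" by (rule strict_mono_imp_increasing)
  then have "Suc m \<le> w (snd (s K))" by (rule K)
  moreover have "w (snd (s K)) = m" using s[of K] w[of "snd (s K)" "Suc K"] by simp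
  ultimately show False by simp
qed

text \<open>Stage \<open>i\<close> raises the lower bound for all undecided entries to
  \<open>i\<close> and, within that cone, escapes the \<open>i\<close>-th intersection. The limit
  stays in every chosen cone, so it tends to infinity and yet lies in none of the
  intersections.\<close>

lemma diverging_sequences_not_Sigma03:
  assumes G: "\<And>i j :: nat. finitely_determined (G i j)"
  shows "{z. filterlim z at_top sequentially} \<noteq> (\<Union>i :: nat. \<Inter>j. G i j)"
proof
  assume eq: "{z. filterlim z at_top sequentially} = (\<Union>i. \<Inter>j. G i j)"
  let ?Q = "\<lambda>i s s' :: (nat \<Rightarrow> nat) \<times> nat. snd s < snd s' \<and> fst s' \<in> seq_cone (fst s) (snd s) i \<and>
    seq_cone (fst s') (snd s') i \<inter> (\<Inter>j. G i j) = {}"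
  have step: "\<exists>s'. True \<and> ?Q i s s'" for i s
  proof -
    have "(\<Inter>j. G i j) \<subseteq> {z. filterlim z at_top sequentially}" unfolding eq by blast
    then obtain z' n' where "snd s < n'" "z' \<in> seq_cone (fst s) (snd s) i" "seq_cone z' n' i \<inter> (\<Inter>j. G i j) = {}"
      using G_delta_avoids_cone[of "G i" "snd s" "fst s" i] G by blast
    then show ?thesis by (intro exI[of _ "(z', n')"]) simp
  qed
  obtain s where s: "\<forall>i. True \<and> ?Q i (s i) (s (Suc i))"
  proof -
    have "\<exists>s. \<forall>i. True \<and> ?Q i (s i) (s (Suc i))"
      by (rule dependent_nat_choice[of "\<lambda>_ _. True" ?Q]) (simp, rule step)
    then show thesis using that by (elim exE)
  qed
  have s: "?Q i (s i) (s (Suc i))" for i using s[THEN spec, of i] by (rule conjunct2)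
  obtain w where w: "\<And>i k. k < snd (s i) \<Longrightarrow> w k = fst (s i) k"
  proof (rule limit_of_stabilizing_sequences)
    show "fst (s (Suc j)) k = fst (s j) k" if "k < snd (s j)" for j k
      using s[of j] that by (simp add: seq_cone_def)
    show "snd (s j) < snd (s (Suc j))" for j using s[of j] by simp
  qed (rule that, blast)
  have mono: "strict_mono (\<lambda>j. snd (s j))" using s by (simp add: strict_mono_Suc_iff)
  have large: "i \<le> fst (s (Suc i + d)) k" if "snd (s (Suc i)) \<le> k" for i d k
  proof (induction d)
    case 0
    show ?case using s[of i] that by (simp add: seq_cone_def)
  next
    case (Suc d)
    show ?case
    proof (cases "k < snd (s (Suc i + d))")
      case True
      then show ?thesis using s[of "Suc i + d"] Suc by (simp add: seq_cone_def)
    next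
      case False
      then have "Suc i + d \<le> fst (s (Suc (Suc i + d))) k"
        using s[of "Suc i + d"] by (simp add: seq_cone_def)
      then show ?thesis by simp
    qed
  qed
  have w_cone: "w \<in> seq_cone (fst (s (Suc i))) (snd (s (Suc i))) i" for i
    unfolding seq_cone_def
  proof (intro CollectI conjI allI impI)
    fix k assume k: "snd (s (Suc i)) \<le> k"
    have "k < snd (s (Suc i + Suc k))"
      using strict_mono_imp_increasing[OF mono, of "Suc i + Suc k"] by simp
    then have "w k = fst (s (Suc i + Suc k)) k" by (rule w)
    then show "i \<le> w k" using large[OF k, of "Suc k"] by simp
  qed (rule w)
  have "w \<notin> (\<Union>i. \<Inter>j. G i j)" using w_cone s by blast
  moreover have "filterlim w at_top sequentially"
    unfolding filterlim_at_top eventually_sequentially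
    using w_cone unfolding seq_cone_def by blast
  ultimately show False using eq by blast
qed

text \<open>Unfolding the recursion gives the series
  \<open>a k + w k * a (k + 1) + w k * w (k + 1) * a (k + 2) + ...\<close>. The bound
  \<open>a k + w k < 1\<close> keeps its partial sums below \<open>1\<close> by induction, and one
  further unfolding makes the bound on the sum strict.\<close>

lemma affine_nested_points:
  fixes a w :: "nat \<Rightarrow> real"
  assumes "\<And>k. 0 \<le> a k" "\<And>k. 0 \<le> w k" "\<And>k. a k + w k < 1"
  shows "\<exists>x. \<forall>k. x k \<in> {0..<1} \<and> x k = a k + w k * x (Suc k)"
proof -
  define t where "t k i = a (k + i) * (\<Prod>l<i. w (k + l))" for k i
  have t_0: "t k 0 = a k" for k by (simp add: t_def)
  have t_Suc: "t k (Suc i) = w k * t (Suc k) i" for k i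
    unfolding t_def prod.lessThan_Suc_shift by simp
  have t_nonneg: "0 \<le> t k i" for k i
    unfolding t_def using assms by (intro mult_nonneg_nonneg prod_nonneg) auto
  have partial: "(\<Sum>i<n. t k i) \<le> 1" for n k
  proof (induction n arbitrary: k)
    case (Suc n)
    have "(\<Sum>i<Suc n. t k i) = a k + w k * (\<Sum>i<n. t (Suc k) i)"
      unfolding sum.lessThan_Suc_shift by (simp add: t_0 t_Suc sum_distrib_left)
    also have "\<dots> \<le> a k + w k * 1"
      using Suc.IH assms by (intro add_left_mono mult_left_mono) auto
    finally show ?case using assms(3)[of k] by simp
  qed simp
  have summable: "summable (t k)" for k
    using t_nonneg partial by (intro summableI_nonneg_bounded[where x = 1]) auto
  have split: "(\<Sum>i. t k i) = a k + w k * (\<Sum>i. t (Suc k) i)" for k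
    using suminf_split_head[OF summable[of k]] suminf_mult[OF summable[of "Suc k"], of "w k"]
    by (simp add: t_0 t_Suc)
  have range: "0 \<le> (\<Sum>i. t k i)" "(\<Sum>i. t k i) \<le> 1" for k
    using suminf_nonneg[OF summable t_nonneg] suminf_le_const[OF summable partial] by auto
  have less: "(\<Sum>i. t k i) < 1" for k
    using split[of k] mult_left_mono[OF range(2)[of "Suc k"] assms(2)[of k]] assms(3)[of k] by linarith
  show ?thesis
  proof (intro exI allI conjI)
    show "(\<Sum>i. t k i) \<in> {0..<1}" for k using range(1)[of k] less[of k] by simp
  qed (rule split)
qed

section \<open>Full cylinders\<close>

context beta_expansion
begin

text \<open>The sum of all \<open>1 / \<beta> ^ i\<close> with \<open>i \<ge> 1\<close>, used
  through its fixed point equation \<open>(1 + \<kappa>) / \<beta> = \<kappa>\<close>.\<close>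

definition geometric_tail :: real ("\<kappa>") where
  "\<kappa> = 1 / (\<beta> - 1)"

lemma kappa_pos: "0 < \<kappa>"
  using beta_gt_1 by (simp add: geometric_tail_def)

lemma kappa_fixed: "(1 + \<kappa>) / \<beta> = \<kappa>"
  using beta_gt_1 by (simp add: geometric_tail_def field_simps)

lemma sum_geometric_le_kappa: "(\<Sum>i<n. 1 / \<beta> ^ (n - i)) \<le> \<kappa>"
proof (induction n)
  case (Suc n)
  have "(\<Sum>i<Suc n. 1 / \<beta> ^ (Suc n - i)) = (\<Sum>i<n. 1 / \<beta> ^ (n - i) / \<beta>) + 1 / \<beta>"
    by (simp add: Suc_diff_le less_imp_le mult.commute)
  also have "\<dots> = ((\<Sum>i<n. 1 / \<beta> ^ (n - i)) + 1) / \<beta>"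
    by (simp add: sum_divide_distrib add_divide_distrib)
  also have "\<dots> \<le> (\<kappa> + 1) / \<beta>"
    using Suc beta_gt_1 by (intro divide_right_mono) auto
  also have "\<dots> = \<kappa>" using kappa_fixed by (simp add: add.commute)
  finally show ?case .
qed (use kappa_pos in simp)

lemma beta_map_eqI:
  assumes "\<beta> * x = of_int d + v" "v \<in> {0..<1}"
  shows "T x = v"
  using assms unfolding beta_map_def by (simp add: frac_eq frac_unique_iff)

lemma zero_digits_orbit:
  assumes "u \<in> {0..<1}" "i \<le> n"
  shows "(T ^^ i) (u / \<beta> ^ n) = u / \<beta> ^ (n - i)"
  using assms(2)
proof (induction i)
  case (Suc i)
  have "u \<le> u * \<beta> ^ (n - Suc i)" "u < \<beta> ^ (n - Suc i)"
    using assms(1) beta_gt_1 one_le_power[of \<beta> "n - Suc i"] mult_left_mono[of 1 "\<beta> ^ (n - Suc i)" u]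
    by (auto intro: less_le_trans)
  then have "u / \<beta> ^ (n - Suc i) \<in> {0..<1}" using assms(1) beta_gt_1 by simp
  moreover have "n - i = Suc (n - Suc i)" using Suc.prems by simp
  then have "\<beta> * (u / \<beta> ^ (n - i)) = of_int 0 + u / \<beta> ^ (n - Suc i)" using beta_gt_1 by simp
  ultimately have "T (u / \<beta> ^ (n - i)) = u / \<beta> ^ (n - Suc i)" by (intro beta_map_eqI[where d = 0])
  then show ?case using Suc by simp
qed simp

text \<open>Within a run of zeros \<open>T\<close> expands by exactly \<open>\<beta>\<close>, so
  read backwards from the end of the run the distances decay geometrically, and the total is
  independent of its length.\<close>

lemma zero_digits_sum_le:
  assumes "u \<in> {0..<1}" "v \<in> {0..<1}"
  shows "(\<Sum>i<n. \<bar>(T ^^ i) (u / \<beta> ^ n) - (T ^^ i) (v / \<beta> ^ n)\<bar>) \<le> \<kappa>"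
proof -
  have "\<bar>(T ^^ i) (u / \<beta> ^ n) - (T ^^ i) (v / \<beta> ^ n)\<bar> \<le> 1 / \<beta> ^ (n - i)" if "i < n" for i
  proof -
    have "\<bar>u - v\<bar> \<le> 1" using assms by auto
    then have "\<bar>u - v\<bar> / \<beta> ^ (n - i) \<le> 1 / \<beta> ^ (n - i)"
      using beta_gt_1 by (intro divide_right_mono) auto
    moreover have "\<bar>u / \<beta> ^ (n - i) - v / \<beta> ^ (n - i)\<bar> = \<bar>u - v\<bar> / \<beta> ^ (n - i)"
      using beta_gt_1 by (simp add: diff_divide_distrib[symmetric])
    ultimately show ?thesis using assms that by (simp add: zero_digits_orbit less_imp_le)
  qed
  then have "(\<Sum>i<n. \<bar>(T ^^ i) (u / \<beta> ^ n) - (T ^^ i) (v / \<beta> ^ n)\<bar>) \<le> (\<Sum>i<n. 1 / \<beta> ^ (n - i))"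
    by (intro sum_mono) simp
  also have "\<dots> \<le> \<kappa>" by (rule sum_geometric_le_kappa)
  finally show ?thesis .
qed

text \<open>Decreasing the last nonzero digit among the first \<open>n\<close> digits of \<open>y\<close> yields a full cylinder:
  \<open>T ^^ n\<close> maps it onto \<open>[0,1)\<close>. If all these digits vanish, the cylinder is already full. In both
  cases the orbits stay summably close to that of \<open>y\<close>, uniformly in \<open>n\<close>. The term weighted by \<open>\<kappa>\<close>
  is exactly the contribution of all digits prepended later, so the bound is stable in the induction.\<close>

lemma full_branch_aux:
  assumes "y \<in> {0..<1}"
  shows "\<exists>a\<ge>0. \<forall>u\<in>{0..<1}. a + u / \<beta> ^ n < 1 \<and> (T ^^ n) (a + u / \<beta> ^ n) = u \<and>
    (\<Sum>i<n. \<bar>(T ^^ i) (a + u / \<beta> ^ n) - (T ^^ i) y\<bar>) + \<kappa> * \<bar>a + u / \<beta> ^ n - y\<bar> \<le> 1 + 2 * \<kappa> \<and>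
    (1 / \<beta> ^ n \<le> y \<longrightarrow> a + u / \<beta> ^ n \<le> y)"
  using assms
proof (induction n arbitrary: y)
  case 0
  have "\<kappa> * \<bar>u - y\<bar> \<le> \<kappa> * 1" if "u \<in> {0..<1}" for u
    using that 0 kappa_pos by (intro mult_left_mono) auto
  then show ?case using 0 kappa_pos by (intro exI[of _ 0]) (auto simp: add_nonneg_nonneg add_increasing)
next
  case (Suc n)
  define d where "d = \<lfloor>\<beta> * y\<rfloor>"
  have y_eq: "\<beta> * y = of_int d + T y" by (simp add: d_def beta_map_def frac_def)
  have d: "0 \<le> d" using Suc.prems beta_gt_1 by (simp add: d_def)
  have Ty: "T y \<in> {0..<1}" by simp
  have kappa_diff: "\<kappa> * \<bar>x - y\<bar> \<le> \<kappa>" if "x \<in> {0..<1}" for x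
    using that Suc.prems kappa_pos mult_left_mono[of "\<bar>x - y\<bar>" 1 \<kappa>] by auto
  have shrink: "0 \<le> u / \<beta> ^ m" "u / \<beta> ^ m < 1" "u / \<beta> ^ m < 1 / \<beta> ^ m" if "u \<in> {0..<1}" for u m
  proof -
    show "0 \<le> u / \<beta> ^ m" using that beta_gt_1 by simp
    show less: "u / \<beta> ^ m < 1 / \<beta> ^ m" using that beta_gt_1 by (intro divide_strict_right_mono) auto
    have "1 / \<beta> ^ m \<le> 1" using beta_gt_1 by (simp add: one_le_power)
    with less show "u / \<beta> ^ m < 1" by simp
  qed
  \<comment> \<open>The cases locate the last nonzero digit: there is none; it lies behind the first
    digit, which is kept while the rest is treated recursively; or it is the first digit, which is
    lowered by one.\<close>
  consider "y < 1 / \<beta> ^ Suc n" | "1 / \<beta> ^ Suc n \<le> y" "1 / \<beta> ^ n \<le> T y"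
    | "1 / \<beta> ^ Suc n \<le> y" "T y < 1 / \<beta> ^ n" by linarith
  then show ?case
  proof cases
    case 1
    define v where "v = y * \<beta> ^ Suc n"
    have v: "v \<in> {0..<1}" using 1 Suc.prems beta_gt_1 by (simp add: v_def pos_less_divide_eq)
    have y: "y = v / \<beta> ^ Suc n" using beta_gt_1 by (simp add: v_def)
    show ?thesis
    proof (intro exI[of _ 0] conjI ballI)
      fix u :: real assume u: "u \<in> {0..<1}"
      show "0 + u / \<beta> ^ Suc n < 1" using shrink(2)[OF u, of "Suc n"] by simp
      show "(T ^^ Suc n) (0 + u / \<beta> ^ Suc n) = u"
        using zero_digits_orbit[OF u, of "Suc n" "Suc n"] by (simp del: power_Suc funpow.simps)
      have "(\<Sum>i<Suc n. \<bar>(T ^^ i) (0 + u / \<beta> ^ Suc n) - (T ^^ i) y\<bar>) \<le> \<kappa>"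
        unfolding y add_0_left using u v by (rule zero_digits_sum_le)
      moreover have "\<kappa> * \<bar>0 + u / \<beta> ^ Suc n - y\<bar> \<le> \<kappa>"
        using shrink[OF u, of "Suc n"] by (intro kappa_diff) simp
      ultimately show "(\<Sum>i<Suc n. \<bar>(T ^^ i) (0 + u / \<beta> ^ Suc n) - (T ^^ i) y\<bar>)
          + \<kappa> * \<bar>0 + u / \<beta> ^ Suc n - y\<bar> \<le> 1 + 2 * \<kappa>" by linarith
    qed (use 1 in auto)
  next
    case 2
    from Suc.IH[OF Ty] obtain b where "0 \<le> b" and
      b: "\<And>u. u \<in> {0..<1} \<Longrightarrow> b + u / \<beta> ^ n < 1"
        "\<And>u. u \<in> {0..<1} \<Longrightarrow> (T ^^ n) (b + u / \<beta> ^ n) = u"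
        "\<And>u. u \<in> {0..<1} \<Longrightarrow> (\<Sum>i<n. \<bar>(T ^^ i) (b + u / \<beta> ^ n) - (T ^^ i) (T y)\<bar>)
          + \<kappa> * \<bar>b + u / \<beta> ^ n - T y\<bar> \<le> 1 + 2 * \<kappa>"
        "\<And>u. u \<in> {0..<1} \<Longrightarrow> 1 / \<beta> ^ n \<le> T y \<longrightarrow> b + u / \<beta> ^ n \<le> T y"
      by blast
    define a where "a = (of_int d + b) / \<beta>"
    show ?thesis
    proof (intro exI[of _ a] conjI ballI impI)
      show "0 \<le> a" using \<open>0 \<le> b\<close> d beta_gt_1 by (simp add: a_def)
      fix u :: real assume u: "u \<in> {0..<1}"
      let ?v = "b + u / \<beta> ^ n" and ?x = "a + u / \<beta> ^ Suc n"
      have v: "?v \<in> {0..<1}" using b(1)[OF u] shrink(1)[OF u, of n] \<open>0 \<le> b\<close> by simp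
      have x: "\<beta> * ?x = of_int d + ?v" using beta_gt_1 by (simp add: a_def field_simps)
      then have Tx: "T ?x = ?v" using v by (rule beta_map_eqI)
      \<comment> \<open>Here the last conjunct of the induction hypothesis is used: staying below
        \<open>T y\<close> ensures that prepending the digit \<open>d\<close> gives a point below
        \<open>y\<close>, hence inside \<open>[0,1)\<close>.\<close>
      have "\<beta> * ?x \<le> \<beta> * y" unfolding x y_eq using b(4)[OF u] 2 by simp
      then show le: "?x \<le> y" using beta_gt_1 by simp
      then show "?x < 1" using Suc.prems by simp
      show "(T ^^ Suc n) ?x = u" using b(2)[OF u] Tx by (simp add: funpow_swap1)
      have "\<beta> * \<bar>?x - y\<bar> = \<bar>\<beta> * ?x - \<beta> * y\<bar>"
        using beta_gt_1 by (simp add: abs_mult flip: right_diff_distrib)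
      also have "\<dots> = \<bar>?v - T y\<bar>" unfolding x y_eq by simp
      finally have "\<bar>?x - y\<bar> + \<kappa> * \<bar>?x - y\<bar> = (1 + \<kappa>) / \<beta> * \<bar>?v - T y\<bar>"
        using beta_gt_1 by (simp add: field_simps)
      then have "\<bar>?x - y\<bar> + \<kappa> * \<bar>?x - y\<bar> = \<kappa> * \<bar>?v - T y\<bar>" unfolding kappa_fixed .
      moreover have "(\<Sum>i<Suc n. \<bar>(T ^^ i) ?x - (T ^^ i) y\<bar>) =
          \<bar>?x - y\<bar> + (\<Sum>i<n. \<bar>(T ^^ i) ?v - (T ^^ i) (T y)\<bar>)"
        unfolding sum.lessThan_Suc_shift by (simp add: funpow_Suc_right Tx del: funpow.simps power_Suc)
      ultimately show "(\<Sum>i<Suc n. \<bar>(T ^^ i) ?x - (T ^^ i) y\<bar>) + \<kappa> * \<bar>?x - y\<bar> \<le> 1 + 2 * \<kappa>"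
        using b(3)[OF u] by linarith
    qed
  next
    case 3
    have "1 / \<beta> ^ n \<le> \<beta> * y" using 3 beta_gt_1 by (simp add: field_simps)
    then have "1 \<le> d" using 3 y_eq d by (cases "d = 0") auto
    define a where "a = (of_int d - 1) / \<beta>"
    define w where "w = T y * \<beta> ^ n"
    have w: "w \<in> {0..<1}" using 3 beta_gt_1 by (simp add: w_def pos_less_divide_eq)
    have Ty_eq: "T y = w / \<beta> ^ n" using beta_gt_1 by (simp add: w_def)
    show ?thesis
    proof (intro exI[of _ a] conjI ballI impI)
      show "0 \<le> a" using \<open>1 \<le> d\<close> beta_gt_1 by (simp add: a_def)
      fix u :: real assume u: "u \<in> {0..<1}"
      let ?v = "u / \<beta> ^ n" and ?x = "a + u / \<beta> ^ Suc n"
      have x: "\<beta> * ?x = of_int (d - 1) + ?v" using beta_gt_1 by (simp add: a_def field_simps)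
      have Tx: "T ?x = ?v" using x shrink[OF u, of n] by (intro beta_map_eqI[of _ "d - 1"]) auto
      have "\<beta> * ?x \<le> \<beta> * y" unfolding x y_eq of_int_diff of_int_1 using shrink(2)[OF u, of n] beta_map_range(1)[of y] by linarith
      then show le: "?x \<le> y" using beta_gt_1 by simp
      then show "?x < 1" using Suc.prems by simp
      \<comment> \<open>The origin of \<open>1 + 2 * \<kappa>\<close>: at most \<open>1\<close> from
        the point whose digit was lowered, \<open>\<kappa>\<close> from the zeros behind it, and
        \<open>\<kappa>\<close> from the weighted term.\<close>
      have "0 \<le> ?x" using \<open>0 \<le> a\<close> shrink(1)[OF u, of "Suc n"] by simp
      with \<open>?x < 1\<close> have "\<kappa> * \<bar>?x - y\<bar> \<le> \<kappa>" by (intro kappa_diff) simp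
      moreover have "\<bar>?x - y\<bar> \<le> 1" using \<open>0 \<le> ?x\<close> \<open>?x < 1\<close> Suc.prems by auto
      moreover have "(T ^^ n) ?v = u" using zero_digits_orbit[OF u, of n n] by simp
      then show "(T ^^ Suc n) ?x = u" using Tx by (simp add: funpow_swap1)
      have "(\<Sum>i<n. \<bar>(T ^^ i) ?v - (T ^^ i) (T y)\<bar>) \<le> \<kappa>"
        unfolding Ty_eq using u w by (rule zero_digits_sum_le)
      moreover have "(\<Sum>i<Suc n. \<bar>(T ^^ i) ?x - (T ^^ i) y\<bar>) =
          \<bar>?x - y\<bar> + (\<Sum>i<n. \<bar>(T ^^ i) ?v - (T ^^ i) (T y)\<bar>)"
        unfolding sum.lessThan_Suc_shift by (simp add: funpow_Suc_right Tx del: funpow.simps power_Suc)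
      ultimately show "(\<Sum>i<Suc n. \<bar>(T ^^ i) ?x - (T ^^ i) y\<bar>) + \<kappa> * \<bar>?x - y\<bar> \<le> 1 + 2 * \<kappa>"
        by linarith
    qed
  qed
qed

lemma full_branch:
  assumes "y \<in> {0..<1}"
  obtains a where "0 \<le> a" "\<And>u. u \<in> {0..<1} \<Longrightarrow> a + u / \<beta> ^ n < 1"
    "\<And>u. u \<in> {0..<1} \<Longrightarrow> (T ^^ n) (a + u / \<beta> ^ n) = u"
    "\<And>u. u \<in> {0..<1} \<Longrightarrow> (\<Sum>i<n. \<bar>(T ^^ i) (a + u / \<beta> ^ n) - (T ^^ i) y\<bar>) \<le> 1 + 2 * \<kappa>"
proof -
  obtain a where "0 \<le> a" and
    a: "\<And>u. u \<in> {0..<1} \<Longrightarrow> a + u / \<beta> ^ n < 1"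
      "\<And>u. u \<in> {0..<1} \<Longrightarrow> (T ^^ n) (a + u / \<beta> ^ n) = u"
      "\<And>u. u \<in> {0..<1} \<Longrightarrow> (\<Sum>i<n. \<bar>(T ^^ i) (a + u / \<beta> ^ n) - (T ^^ i) y\<bar>)
        + \<kappa> * \<bar>a + u / \<beta> ^ n - y\<bar> \<le> 1 + 2 * \<kappa>"
    using full_branch_aux[OF assms, of n] by blast
  have "0 \<le> \<kappa> * t" if "0 \<le> t" for t using kappa_pos that by simp
  then have "(\<Sum>i<n. \<bar>(T ^^ i) (a + u / \<beta> ^ n) - (T ^^ i) y\<bar>) \<le> 1 + 2 * \<kappa>" if "u \<in> {0..<1}" for u
    using a(3)[OF that] abs_ge_zero[of "a + u / \<beta> ^ n - y"] by (smt (verit))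
  with \<open>0 \<le> a\<close> a(1,2) show thesis by (rule that)
qed

end

section \<open>Insertion of runs of zeros\<close>

lemma affine_over_power_two: "(\<lambda>k. (real k + c) / 2 ^ k) \<longlonglongrightarrow> 0"
proof -
  have "(\<lambda>k. real k / 2 ^ k + c * (1 / 2) ^ k) \<longlonglongrightarrow> 0 + c * 0"
    by (intro tendsto_add tendsto_mult tendsto_const lim_n_over_pown LIMSEQ_power_zero) simp_all
  then show ?thesis by (simp add: add_divide_distrib power_divide)
qed

text \<open>The digits of \<open>X 0\<close> are those of \<open>y\<close>, cut into blocks of length \<open>2 ^ k\<close>: the \<open>k\<close>-th block is
  changed in at most one digit, to make its cylinder full, and is followed by \<open>run k\<close> zeros. The
  tail \<open>X k\<close> starts at the \<open>k\<close>-th block.\<close>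

locale zero_insertion = beta_expansion +
  fixes y :: real and a :: "nat \<Rightarrow> real" and z :: "nat \<Rightarrow> nat" and X :: "nat \<Rightarrow> real"
  assumes y_range: "y \<in> {0..<1}"
    and branch_orbit: "\<And>u k. u \<in> {0..<1} \<Longrightarrow> (T ^^ 2 ^ k) (a k + u / \<beta> ^ 2 ^ k) = u"
    and branch_close: "\<And>u k. u \<in> {0..<1} \<Longrightarrow>
      (\<Sum>i<2 ^ k. \<bar>(T ^^ i) (a k + u / \<beta> ^ 2 ^ k) - (T ^^ i) ((T ^^ (2 ^ k - 1)) y)\<bar>) \<le> 1 + 2 * \<kappa>"
    and X_range: "\<And>k. X k \<in> {0..<1}"
    and X_eq: "\<And>k. X k = a k + 1 / \<beta> ^ (2 ^ k + (1 + 2 ^ k div (z k + 1))) * X (Suc k)"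
begin

text \<open>The extra zero keeps the run nonempty even if \<open>z k \<ge> 2 ^ k\<close>. Then
  \<open>1 / \<beta> ^ run k < 1\<close>, so this value is an admissible argument of the full
  branch.\<close>

definition run :: "nat \<Rightarrow> nat" where
  "run k = 1 + 2 ^ k div (z k + 1)"

definition zeros :: "nat \<Rightarrow> nat" where
  "zeros k = (\<Sum>j<k. run j)"

text \<open>The time at which the \<open>k\<close>-th block begins: the earlier blocks use
  \<open>1 + 2 + ... + 2 ^ (k - 1) = 2 ^ k - 1\<close> digits of \<open>y\<close>.\<close>

definition pos :: "nat \<Rightarrow> nat" where
  "pos k = (2 ^ k - 1) + zeros k"

abbreviation power_sum :: "nat \<Rightarrow> nat \<Rightarrow> real \<Rightarrow> real" where
  "power_sum q N x \<equiv> birkhoff_sum T (\<lambda>t. t ^ q) N x"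

lemma zeros_Suc: "zeros (Suc k) = zeros k + run k"
  by (simp add: zeros_def)

lemma pos_0: "pos 0 = 0"
  by (simp add: pos_def zeros_def)

lemma block_end: "2 ^ Suc k - 1 = (2 ^ k - 1) + (2 ^ k :: nat)"
  by (simp add: mult_2)

lemma pos_Suc: "pos (Suc k) = pos k + (2 ^ k + run k)"
  unfolding pos_def zeros_Suc block_end by (simp only: ac_simps)

lemma le_zeros: "k \<le> zeros k"
  by (induction k) (simp_all add: zeros_Suc run_def)

lemma power_two_le_pos:
  assumes "k > 0"
  shows "2 ^ k \<le> pos k"
  using le_zeros[of k] assms unfolding pos_def by simp

lemma zeros_le: "zeros k \<le> k + 2 ^ k"
proof (induction k)
  case (Suc k)
  have "2 ^ k div (z k + 1) \<le> (2 :: nat) ^ k" by (rule div_le_dividend)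
  with Suc show ?case unfolding zeros_Suc run_def power_Suc by linarith
qed (simp add: zeros_def)

definition run_start :: "nat \<Rightarrow> real" where
  "run_start k = X (Suc k) / \<beta> ^ run k"

lemma run_start_range: "run_start k \<in> {0..<1}"
proof -
  have "1 \<le> \<beta> ^ run k" using beta_gt_1 by (intro one_le_power) simp
  then have "X (Suc k) / \<beta> ^ run k \<le> X (Suc k) / 1"
    using X_range[of "Suc k"] by (intro divide_left_mono) auto
  moreover have "0 \<le> X (Suc k) / \<beta> ^ run k" using X_range[of "Suc k"] beta_gt_1 by simp
  ultimately show ?thesis using X_range[of "Suc k"] unfolding run_start_def atLeastLessThan_iff
    by linarith
qed

lemma X_block: "X k = a k + run_start k / \<beta> ^ 2 ^ k"
  using X_eq[of k] by (simp add: run_start_def run_def power_add field_simps)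

lemma orbit_block: "(T ^^ 2 ^ k) (X k) = run_start k"
  using branch_orbit[OF run_start_range, of k k] unfolding X_block[symmetric] .

lemma orbit_run: "(T ^^ run k) (run_start k) = X (Suc k)"
  unfolding run_start_def using zero_digits_orbit[OF X_range order_refl] by simp

lemma orbit_pos: "(T ^^ pos k) (X 0) = X k"
proof (induction k)
  case (Suc k)
  have "pos (Suc k) = run k + (2 ^ k + pos k)" by (simp add: pos_Suc)
  then show ?case using Suc by (simp only: funpow_add o_apply orbit_block orbit_run)
qed (simp add: pos_0)

lemma power_sum_range:
  assumes "x \<in> {0..<1}"
  shows "0 \<le> power_sum q N x" "power_sum q N x \<le> real N"
proof -
  have "0 \<le> ((T ^^ i) x) ^ q \<and> ((T ^^ i) x) ^ q \<le> 1" for i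
    using orbit_range[OF assms, of i] by (simp add: power_le_one)
  then show "0 \<le> power_sum q N x" "power_sum q N x \<le> real N"
    unfolding birkhoff_sum_def using sum_bounded_above[of "{..<N}" "\<lambda>i. ((T ^^ i) x) ^ q" 1]
    by (auto intro: sum_nonneg)
qed

lemma power_sum_tail_le:
  assumes "x \<in> {0..<1}"
  shows "\<bar>power_sum q (m + n) x - power_sum q m x\<bar> \<le> real n"
  using power_sum_range[OF orbit_range[OF assms, of m], of q n] by (simp add: birkhoff_sum_add)

text \<open>On \<open>[0,1]\<close> the function \<open>t ^ q\<close> has Lipschitz constant
  \<open>q\<close>, so the bound on the total orbit distance carries over, and it covers every
  initial part of the block.\<close>

lemma power_sum_block:
  assumes "i \<le> 2 ^ k"
  shows "\<bar>power_sum q i (X k) - power_sum q i ((T ^^ (2 ^ k - 1)) y)\<bar> \<le> real q * (1 + 2 * \<kappa>)"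
proof -
  let ?y = "(T ^^ (2 ^ k - 1)) y"
  have y: "?y \<in> {0..<1}" using y_range by (rule orbit_range)
  have "\<bar>power_sum q i (X k) - power_sum q i ?y\<bar> \<le>
      (\<Sum>j<i. \<bar>((T ^^ j) (X k)) ^ q - ((T ^^ j) ?y) ^ q\<bar>)"
    unfolding birkhoff_sum_def sum_subtractf[symmetric] by (rule sum_abs)
  also have "\<dots> \<le> (\<Sum>j<i. real q * \<bar>(T ^^ j) (X k) - (T ^^ j) ?y\<bar>)"
  proof (rule sum_mono)
    fix j
    show "\<bar>((T ^^ j) (X k)) ^ q - ((T ^^ j) ?y) ^ q\<bar> \<le> real q * \<bar>(T ^^ j) (X k) - (T ^^ j) ?y\<bar>"
      using norm_power_diff[of "(T ^^ j) (X k)" "(T ^^ j) ?y" q]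
        orbit_range[OF X_range, of j k] orbit_range[OF y, of j] by simp
  qed
  also have "\<dots> \<le> (\<Sum>j<2 ^ k. real q * \<bar>(T ^^ j) (X k) - (T ^^ j) ?y\<bar>)"
    using assms by (intro sum_mono2) auto
  also have "\<dots> = real q * (\<Sum>j<2 ^ k. \<bar>(T ^^ j) (X k) - (T ^^ j) ?y\<bar>)"
    by (rule sum_distrib_left[symmetric])
  also have "(\<Sum>j<2 ^ k. \<bar>(T ^^ j) (X k) - (T ^^ j) ?y\<bar>) \<le> 1 + 2 * \<kappa>"
    using branch_close[OF run_start_range, of k k] unfolding X_block[symmetric] .
  finally show ?thesis by (simp add: mult_left_mono)
qed

text \<open>Each block costs a constant and each inserted zero at most \<open>1\<close>.\<close>

lemma power_sum_pos:
  "\<bar>power_sum q (pos k) (X 0) - power_sum q (2 ^ k - 1) y\<bar> \<le> real k * (real q * (1 + 2 * \<kappa>)) + real (zeros k)"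
proof (induction k)
  case 0
  show ?case by (simp add: pos_0 zeros_def)
next
  case (Suc k)
  define c where "c = real q * (1 + 2 * \<kappa>)"
  have x: "power_sum q (pos (Suc k)) (X 0) = power_sum q (pos k) (X 0) + (power_sum q (2 ^ k) (X k)
      + power_sum q (run k) (run_start k))"
    unfolding pos_Suc birkhoff_sum_add orbit_pos orbit_block ..
  have y: "power_sum q (2 ^ Suc k - 1) y = power_sum q (2 ^ k - 1) y +
      power_sum q (2 ^ k) ((T ^^ (2 ^ k - 1)) y)"
    unfolding block_end by (rule birkhoff_sum_add)
  have run: "\<bar>power_sum q (run k) (run_start k)\<bar> \<le> real (run k)"
    using power_sum_range[OF run_start_range, of q "run k" k] by simp
  have rhs: "real (Suc k) * c + real (zeros (Suc k)) = real k * c + real (zeros k) + c + real (run k)"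
    by (simp add: zeros_Suc algebra_simps)
  show ?case
    using Suc.IH power_sum_block[OF order_refl, of q k] run
    unfolding x y rhs c_def[symmetric] by linarith
qed

text \<open>Time \<open>N\<close> falls \<open>i\<close> steps into the block and \<open>l\<close>
  steps into the run after it. Inserted zeros count twice: once for the terms they add to the orbit
  of \<open>X 0\<close>, and once because at equal time \<open>y\<close> has read that many more of
  its own digits.\<close>

lemma power_sum_compare:
  assumes "pos k \<le> N" "N \<le> pos (Suc k)"
  shows "\<bar>power_sum q N (X 0) - power_sum q N y\<bar> \<le>
    real (Suc k) * (real q * (1 + 2 * \<kappa>)) + 2 * real (zeros (Suc k))"
proof -
  define i where "i = min (N - pos k) (2 ^ k)"
  define l where "l = N - pos k - i"
  have i: "i \<le> 2 ^ k" and l: "l \<le> run k" and N: "N = pos k + (i + l)"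
    using assms by (auto simp: i_def l_def pos_Suc)
  have N': "N = ((2 ^ k - 1) + i) + (zeros k + l)" unfolding N pos_def by (simp only: ac_simps)
  have "power_sum q N (X 0) = power_sum q (pos k) (X 0) + power_sum q (i + l) (X k)"
    unfolding N birkhoff_sum_add[of _ _ "pos k"] orbit_pos ..
  moreover have "\<bar>power_sum q (i + l) (X k) - power_sum q i (X k)\<bar> \<le> real l"
    using X_range by (rule power_sum_tail_le)
  moreover have "\<bar>power_sum q N y - power_sum q ((2 ^ k - 1) + i) y\<bar> \<le> real (zeros k + l)"
    unfolding N' using y_range by (rule power_sum_tail_le)
  moreover have "power_sum q ((2 ^ k - 1) + i) y = power_sum q (2 ^ k - 1) y +
      power_sum q i ((T ^^ (2 ^ k - 1)) y)"
    by (rule birkhoff_sum_add)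
  moreover have "real (zeros k + l) \<le> real (zeros k) + real (run k)" "real l \<le> real (run k)"
    using l by simp_all
  moreover define c where "c = real q * (1 + 2 * \<kappa>)"
  moreover have "real (Suc k) * c + 2 * real (zeros (Suc k)) =
      real k * c + c + 2 * real (zeros k) + 2 * real (run k)"
    by (simp add: zeros_Suc algebra_simps)
  ultimately show ?thesis
    using power_sum_pos[of q k] power_sum_block[OF i, of q]
    unfolding c_def[symmetric] by linarith
qed

lemma between_pos:
  obtains k where "pos k \<le> N" "N < pos (Suc k)"
proof -
  have "\<exists>k. pos k \<le> N \<and> N < pos (Suc k)"
  proof (induction N)
    case 0
    then show ?case by (intro exI[of _ 0]) (simp add: pos_0 pos_Suc run_def)
  next
    case (Suc N)
    then obtain k where k: "pos k \<le> N" "N < pos (Suc k)" by blast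
    show ?case
    proof (cases "Suc N < pos (Suc k)")
      case True
      then show ?thesis using k by (intro exI[of _ k]) simp
    next
      case False
      then have "Suc N = pos (Suc k)" using k by simp
      then show ?thesis by (intro exI[of _ "Suc k"]) (simp add: pos_Suc[of "Suc k"])
    qed
  qed
  then show thesis using that by blast
qed

lemma zeros_negligible:
  assumes z: "filterlim z at_top sequentially"
  shows "(\<lambda>k. real (zeros k) / 2 ^ k) \<longlonglongrightarrow> 0"
proof (rule LIMSEQ_I)
  fix e :: real assume "e > 0"
  then obtain m :: nat where m: "1 / real (Suc m) < e / 2" using nat_approx_posE[of "e / 2"] by auto
  obtain J where J: "\<And>j. j \<ge> J \<Longrightarrow> m \<le> z j"
    using z unfolding filterlim_at_top eventually_sequentially by blast
  have bound: "real (zeros k) \<le> real k + 2 ^ J + e / 2 * 2 ^ k" for k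
  proof -
    \<comment> \<open>Before stage \<open>J\<close> only \<open>run k \<le> 1 + 2 ^ k\<close> is
      known, which sums to at most \<open>2 ^ J\<close> besides the linear term; from
      \<open>J\<close> on each run is at most \<open>1 + e / 2 * 2 ^ k\<close>, again a geometric
      sum.\<close>
    have "real (zeros k) \<le> real k + 2 ^ min k J + e / 2 * 2 ^ k"
    proof (induction k)
      case 0
      show ?case using \<open>e > 0\<close> by (simp add: zeros_def)
    next
      case (Suc k)
      show ?case
      proof (cases "k < J")
        case True
        have "run k \<le> 1 + 2 ^ k" unfolding run_def by (intro add_left_mono div_le_dividend)
        then have "real (run k) \<le> real (1 + 2 ^ k)" by (simp only: of_nat_le_iff)
        then have "real (run k) \<le> 1 + 2 ^ k" by simp
        moreover have "min (Suc k) J = Suc (min k J)" "min k J = k" using True by auto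
        moreover have "0 \<le> e / 2 * 2 ^ k" using \<open>e > 0\<close> by simp
        ultimately show ?thesis using Suc by (simp add: zeros_Suc)
      next
        case False
        have "real (2 ^ k div (z k + 1)) \<le> real (2 ^ k) / real (z k + 1)"
          by (rule of_nat_div_le_of_nat)
        also have "\<dots> \<le> 2 ^ k / real (Suc m)"
          using J[of k] False by (simp add: frac_le)
        also have "\<dots> = 1 / real (Suc m) * 2 ^ k" by simp
        also have "\<dots> \<le> e / 2 * 2 ^ k" using m by (intro mult_right_mono) auto
        finally have "real (run k) \<le> 1 + e / 2 * 2 ^ k" by (simp add: run_def)
        moreover have "min (Suc k) J = J" "min k J = J" using False by auto
        ultimately show ?thesis using Suc by (simp add: zeros_Suc algebra_simps)
      qed
    qed
    also have "\<dots> \<le> real k + 2 ^ J + e / 2 * 2 ^ k" by (simp add: power_increasing)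
    finally show ?thesis .
  qed
  have lim: "(\<lambda>k. (real k + 2 ^ J) / 2 ^ k) \<longlonglongrightarrow> 0" by (rule affine_over_power_two)
  obtain K where K: "\<And>k. k \<ge> K \<Longrightarrow> \<bar>(real k + 2 ^ J) / 2 ^ k\<bar> < e / 2"
    using LIMSEQ_D[OF lim half_gt_zero[OF \<open>e > 0\<close>]] unfolding real_norm_def diff_0_right by blast
  show "\<exists>K. \<forall>k\<ge>K. norm (real (zeros k) / 2 ^ k - 0) < e"
  proof (intro exI allI impI)
    fix k assume "K \<le> k"
    have "real (zeros k) / 2 ^ k \<le> (real k + 2 ^ J + e / 2 * 2 ^ k) / 2 ^ k"
      using bound by (intro divide_right_mono) auto
    also have "\<dots> = (real k + 2 ^ J) / 2 ^ k + e / 2" by (simp add: add_divide_distrib)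
    also have "\<dots> < e" using K[OF \<open>K \<le> k\<close>] unfolding abs_less_iff by linarith
    finally show "norm (real (zeros k) / 2 ^ k - 0) < e" by simp
  qed
qed

text \<open>For \<open>N\<close> between \<open>pos k\<close> and \<open>pos (Suc k)\<close> the
  power sums of \<open>X 0\<close> and \<open>y\<close> differ by a quantity of smaller order than
  \<open>2 ^ k\<close>, whereas \<open>N\<close> is at least \<open>2 ^ k\<close>.\<close>

lemma normal_if_diverging:
  assumes y: "beta_normal \<beta> y" and z: "filterlim z at_top sequentially"
  shows "beta_normal \<beta> (X 0)"
  unfolding beta_normal_iff_moments[OF X_range]
proof
  fix q
  define err where "err k = real (Suc k) * (real q * (1 + 2 * \<kappa>)) + 2 * real (zeros (Suc k))" for k
  have "(\<lambda>k. (real q * (1 + 2 * \<kappa>)) * ((real k + 1) / 2 ^ k)) \<longlonglongrightarrow> real q * (1 + 2 * \<kappa>) * 0"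
    by (intro tendsto_mult tendsto_const affine_over_power_two)
  then have "(\<lambda>k. real (Suc k) * (real q * (1 + 2 * \<kappa>)) / 2 ^ k) \<longlonglongrightarrow> 0"
    by (simp add: mult.commute add.commute)
  moreover have "(\<lambda>k. 4 * (real (zeros (Suc k)) / 2 ^ Suc k)) \<longlonglongrightarrow> 4 * 0"
    by (intro tendsto_mult tendsto_const LIMSEQ_Suc zeros_negligible[OF z])
  ultimately have "(\<lambda>k. real (Suc k) * (real q * (1 + 2 * \<kappa>)) / 2 ^ k
      + 4 * (real (zeros (Suc k)) / 2 ^ Suc k)) \<longlonglongrightarrow> 0 + 4 * 0"
    by (rule tendsto_add)
  then have err: "(\<lambda>k. err k / 2 ^ k) \<longlonglongrightarrow> 0"
    unfolding err_def by (simp add: add_divide_distrib)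
  have "(\<lambda>N. power_sum q N (X 0) / real N - power_sum q N y / real N) \<longlonglongrightarrow> 0"
  proof (rule LIMSEQ_I)
    fix e :: real assume "e > 0"
    then obtain K where K: "\<And>k. k \<ge> K \<Longrightarrow> \<bar>err k / 2 ^ k\<bar> < e"
      using LIMSEQ_D[OF err] unfolding real_norm_def diff_0_right by blast
    have pos_mono: "pos i \<le> pos j" if "i \<le> j" for i j
      using that by (rule lift_Suc_mono_le[rotated]) (simp add: pos_Suc)
    show "\<exists>N0. \<forall>N\<ge>N0. norm (power_sum q N (X 0) / real N - power_sum q N y / real N - 0) < e"
    proof (intro exI allI impI)
      fix N assume N: "pos (Suc K) \<le> N"
      obtain k where k: "pos k \<le> N" "N < pos (Suc k)" by (rule between_pos)
      \<comment> \<open>Strictness also yields \<open>k > 0\<close>; the bound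
        \<open>2 ^ k \<le> pos k\<close> fails at \<open>k = 0\<close>.\<close>
      have "K < k"
      proof (rule ccontr)
        assume "\<not> K < k"
        then have "pos (Suc k) \<le> pos (Suc K)" by (intro pos_mono) simp
        then show False using N k by simp
      qed
      then have "2 ^ k \<le> pos k" by (intro power_two_le_pos) simp
      then have "2 ^ k \<le> N" using k by simp
      then have N2: "2 ^ k \<le> real N" by (metis of_nat_le_iff of_nat_numeral of_nat_power)
      then have "0 < real N" by (rule less_le_trans[rotated]) simp
      have "\<bar>power_sum q N (X 0) - power_sum q N y\<bar> \<le> err k"
        unfolding err_def using k by (intro power_sum_compare) auto
      also have "err k < e * 2 ^ k"
        using K[of k] \<open>K < k\<close> by (simp add: abs_less_iff pos_divide_less_eq)
      also have "\<dots> \<le> e * real N" using N2 \<open>e > 0\<close> by (intro mult_left_mono) auto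
      finally have "\<bar>power_sum q N (X 0) - power_sum q N y\<bar> / real N < e"
        using \<open>0 < real N\<close> by (simp add: pos_divide_less_eq)
      then show "norm (power_sum q N (X 0) / real N - power_sum q N y / real N - 0) < e"
        by (simp add: diff_divide_distrib[symmetric])
    qed
  qed
  moreover have "(\<lambda>N. power_sum q N y / real N) \<longlonglongrightarrow> (\<integral>t. t ^ q \<partial>\<mu>)"
    using y beta_normal_iff_moments[OF y_range] by blast
  ultimately have "(\<lambda>N. (power_sum q N (X 0) / real N - power_sum q N y / real N)
      + power_sum q N y / real N) \<longlonglongrightarrow> 0 + (\<integral>t. t ^ q \<partial>\<mu>)"
    by (rule tendsto_add)
  then show "(\<lambda>N. power_sum q N (X 0) / real N) \<longlonglongrightarrow> (\<integral>t. t ^ q \<partial>\<mu>)" by simp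
qed

text \<open>During a run of zeros the orbit stays near \<open>0\<close>, so the average of \<open>T\<^sup>i x\<close> drops by a factor
  bounded away from \<open>1\<close> whenever \<open>z k\<close> is bounded.\<close>

lemma diverging_if_normal:
  assumes normal: "beta_normal \<beta> (X 0)"
  shows "filterlim z at_top sequentially"
proof (rule ccontr)
  assume "\<not> filterlim z at_top sequentially"
  then obtain M where "\<not> eventually (\<lambda>k. M \<le> z k) sequentially"
    unfolding filterlim_at_top by blast
  then have often: "\<exists>k\<ge>K. z k < M" for K
    unfolding eventually_sequentially by (meson not_less)
  then have "M > 0" by (metis less_nat_zero_code neq0_conv)
  define m where "m = (\<integral>t. t ^ 1 \<partial>\<mu>)"
  have "0 < m" using parry_mean_pos by (simp add: m_def)
  \<comment> \<open>A run with \<open>z k < M\<close> lasts at least \<open>\<delta>\<close> times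
    the time \<open>P\<close> elapsed before it, since \<open>P \<le> 4 * 2 ^ k\<close> and
    \<open>2 ^ k \<le> M * run k\<close>.\<close>
  define \<delta> where "\<delta> = 1 / (4 * real M)"
  have "0 < \<delta>" using \<open>M > 0\<close> by (simp add: \<delta>_def)
  \<comment> \<open>Chosen so that the loss \<open>2 * e + e * \<delta>\<close> in the final
    comparison is half of the gain \<open>m * \<delta>\<close>.\<close>
  define e where "e = m * \<delta> / (2 * (2 + \<delta>))"
  have "0 < e" using \<open>0 < m\<close> \<open>0 < \<delta>\<close> by (simp add: e_def)
  have "e * (2 * (2 + \<delta>)) = m * \<delta>" using \<open>0 < \<delta>\<close> by (simp add: e_def)
  then have e_eq: "m * \<delta> - 2 * e - e * \<delta> = m * \<delta> / 2" by (simp add: algebra_simps)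
  have conv: "(\<lambda>N. power_sum 1 N (X 0) / real N) \<longlonglongrightarrow> m"
    using normal unfolding m_def beta_normal_iff_moments[OF X_range] by blast
  obtain N0 where N0: "\<And>N. N \<ge> N0 \<Longrightarrow> \<bar>power_sum 1 N (X 0) / real N - m\<bar> < e"
    using LIMSEQ_D[OF conv \<open>0 < e\<close>] unfolding real_norm_def by blast
  obtain L :: nat where L: "\<kappa> / (m * \<delta> / 2) < real L" using reals_Archimedean2 by blast
  obtain k where k: "k \<ge> Suc (N0 + L)" "z k < M" using often by blast
  \<comment> \<open>The run of zeros begins at time \<open>P\<close> and ends at \<open>P'\<close>.
    Normality would make the orbit sum grow by at least about \<open>m * \<delta> * P\<close> in
    between, but it grows by at most \<open>\<kappa>\<close>; \<open>L\<close> makes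
    \<open>P\<close> large enough for a contradiction.\<close>
  define P where "P = pos k + 2 ^ k"
  have "N0 + L < 2 ^ k" using k(1) less_exp[of k] by linarith
  then have P_ge: "N0 + L < P" by (simp add: P_def)
  have "P \<le> 4 * 2 ^ k"
    using zeros_le[of k] less_exp[of k] unfolding P_def pos_def by linarith
  then have "real P \<le> 4 * 2 ^ k" by (metis of_nat_le_iff of_nat_mult of_nat_numeral of_nat_power)
  moreover have "2 ^ k \<le> real M * real (run k)"
  proof -
    have "2 ^ k = (2 ^ k div (z k + 1)) * (z k + 1) + 2 ^ k mod (z k + 1)"
      by (rule div_mult_mod_eq[symmetric])
    also have "\<dots> \<le> (2 ^ k div (z k + 1)) * (z k + 1) + (z k + 1)"
      by (intro add_left_mono less_imp_le mod_less_divisor) simp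
    also have "\<dots> = run k * (z k + 1)" by (simp add: run_def)
    also have "\<dots> \<le> run k * M" using k(2) by (intro mult_left_mono) auto
    finally have "2 ^ k \<le> run k * M" .
    then show ?thesis by (metis mult.commute of_nat_le_iff of_nat_mult of_nat_numeral of_nat_power)
  qed
  ultimately have "real P \<le> 4 * real M * real (run k)" by linarith
  then have run_ge: "\<delta> * real P \<le> real (run k)" using \<open>M > 0\<close> by (simp add: \<delta>_def field_simps)
  define P' where "P' = P + run k"
  have "(T ^^ P) (X 0) = run_start k"
    unfolding P_def by (subst add.commute) (simp add: funpow_add orbit_pos orbit_block)
  then have sum_P': "power_sum 1 P' (X 0) = power_sum 1 P (X 0) + power_sum 1 (run k) (run_start k)"
    unfolding P'_def by (simp add: birkhoff_sum_add)
  have "power_sum 1 (run k) (run_start k) \<le> (\<Sum>i<run k. 1 / \<beta> ^ (run k - i))"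
    unfolding birkhoff_sum_def
  proof (rule sum_mono)
    fix i assume "i \<in> {..<run k}"
    then have "(T ^^ i) (run_start k) = X (Suc k) / \<beta> ^ (run k - i)"
      unfolding run_start_def using X_range by (intro zero_digits_orbit) auto
    also have "\<dots> \<le> 1 / \<beta> ^ (run k - i)"
      using X_range[of "Suc k"] beta_gt_1 by (intro divide_right_mono) auto
    finally show "((T ^^ i) (run_start k)) ^ 1 \<le> 1 / \<beta> ^ (run k - i)" by simp
  qed
  also have "\<dots> \<le> \<kappa>" by (rule sum_geometric_le_kappa)
  finally have run_sum: "power_sum 1 P' (X 0) \<le> power_sum 1 P (X 0) + \<kappa>" using sum_P' by simp
  have "0 < real P" "0 < real P'" using P_ge by (simp_all add: P'_def)
  have "power_sum 1 P (X 0) / real P < m + e" using N0[of P] P_ge by (simp add: abs_less_iff)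
  then have up: "power_sum 1 P (X 0) < (m + e) * real P"
    using \<open>0 < real P\<close> by (simp add: pos_divide_less_eq)
  have "m - e < power_sum 1 P' (X 0) / real P'"
    using N0[of P'] P_ge by (simp add: P'_def abs_less_iff)
  then have low: "(m - e) * real P' < power_sum 1 P' (X 0)"
    using \<open>0 < real P'\<close> by (simp add: pos_less_divide_eq)
  have "e * (2 * (2 + \<delta>)) < m * (2 * (2 + \<delta>))"
    unfolding \<open>e * (2 * (2 + \<delta>)) = m * \<delta>\<close>
    using \<open>0 < m\<close> \<open>0 < \<delta>\<close> by (intro mult_strict_left_mono) auto
  then have "e < m" using \<open>0 < \<delta>\<close> by simp
  then have "(m - e) * ((1 + \<delta>) * real P) \<le> (m - e) * real P'"
    using run_ge by (intro mult_left_mono) (auto simp: P'_def algebra_simps)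
  then have "(m - e) * ((1 + \<delta>) * real P) < (m + e) * real P + \<kappa>"
    using low up run_sum by linarith
  then have "(m * \<delta> - 2 * e - e * \<delta>) * real P < \<kappa>" by (simp add: algebra_simps)
  then have "m * \<delta> / 2 * real P < \<kappa>" unfolding e_eq .
  moreover have "\<kappa> < m * \<delta> / 2 * real L"
    using L \<open>0 < m\<close> \<open>0 < \<delta>\<close> by (simp add: field_simps)
  moreover have "m * \<delta> / 2 * real L \<le> m * \<delta> / 2 * real P"
    using P_ge \<open>0 < m\<close> \<open>0 < \<delta>\<close> by (intro mult_left_mono) auto
  ultimately show False by linarith
qed

end

context beta_expansion
begin

lemma normal_set_not_Sigma03:
  "\<not> Sigma0_in (top_of_set {0..<1}) 3 {x \<in> {0..<1}. beta_normal \<beta> x}"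
proof
  assume "Sigma0_in (top_of_set {0..<1}) 3 {x \<in> {0..<1}. beta_normal \<beta> x}"
  then obtain U :: "nat \<Rightarrow> nat \<Rightarrow> real set"
    where U: "\<And>i j. openin (top_of_set {0..<1}) (U i j)"
      and eq: "{x \<in> {0..<1}. beta_normal \<beta> x} = (\<Union>i. topspace (top_of_set {0..<1}) \<inter> (\<Inter>j. U i j))"
    by (rule Sigma0_in_3D) blast
  obtain y where y: "y \<in> {0..<1}" "beta_normal \<beta> y" using beta_normal_exists by blast
  let ?y = "\<lambda>k. (T ^^ (2 ^ k - 1)) y"
  have "\<exists>a. 0 \<le> a \<and> (\<forall>u\<in>{0..<1}. a + u / \<beta> ^ 2 ^ k < 1 \<and> (T ^^ 2 ^ k) (a + u / \<beta> ^ 2 ^ k) = u \<and>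
      (\<Sum>i<2 ^ k. \<bar>(T ^^ i) (a + u / \<beta> ^ 2 ^ k) - (T ^^ i) (?y k)\<bar>) \<le> 1 + 2 * \<kappa>)" (is "\<exists>a. ?branch k a")
    for k :: nat
    by (rule full_branch[OF orbit_range[OF y(1)], of "2 ^ k" "2 ^ k - 1"]) (intro exI conjI ballI)
  then have "\<forall>k. \<exists>a. ?branch k a" ..
  from choice[OF this] obtain a where "\<forall>k. ?branch k (a k)" ..
  then have a: "0 \<le> a k" "u \<in> {0..<1} \<Longrightarrow> a k + u / \<beta> ^ 2 ^ k < 1"
      "u \<in> {0..<1} \<Longrightarrow> (T ^^ 2 ^ k) (a k + u / \<beta> ^ 2 ^ k) = u"
      "u \<in> {0..<1} \<Longrightarrow>
        (\<Sum>i<2 ^ k. \<bar>(T ^^ i) (a k + u / \<beta> ^ 2 ^ k) - (T ^^ i) (?y k)\<bar>) \<le> 1 + 2 * \<kappa>" for u k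
    by blast+
  define w where "w z k = 1 / \<beta> ^ (2 ^ k + (1 + 2 ^ k div (z k + 1)))" for z :: "nat \<Rightarrow> nat" and k :: nat
  have w: "0 \<le> w z k" "w z k \<le> 1 / \<beta>" "a k + w z k < 1" for z k
  proof -
    \<comment> \<open>With \<open>u = 1 / \<beta> ^ Suc r\<close> in \<open>[0,1)\<close>, the
      weight is \<open>u / \<beta> ^ 2 ^ k\<close>, so the range of the full branch gives
      \<open>a k + w z k < 1\<close>.\<close>
    define r where "r = (2 :: nat) ^ k div (z k + 1)"
    have w_eq: "w z k = 1 / \<beta> ^ Suc r / \<beta> ^ 2 ^ k"
      unfolding w_def r_def by (simp add: power_add)
    have ge1: "1 \<le> \<beta> ^ n" for n using beta_gt_1 by (intro one_le_power) simp
    show "0 \<le> w z k" unfolding w_def using beta_gt_1 by simp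
    have "1 / \<beta> ^ Suc r \<le> 1 / \<beta>"
      using ge1[of r] beta_gt_1 mult_left_mono[OF ge1[of r], of \<beta>] by (intro divide_left_mono) auto
    moreover have "1 / \<beta> < 1" using beta_gt_1 by simp
    ultimately have "1 / \<beta> ^ Suc r < 1" by linarith
    moreover have "0 \<le> 1 / \<beta> ^ Suc r" using beta_gt_1 by simp
    ultimately show "a k + w z k < 1"
      unfolding w_eq by (intro a(2)) (simp only: atLeastLessThan_iff)
    have "w z k \<le> 1 / \<beta> ^ Suc r / 1"
      unfolding w_eq using ge1 beta_gt_1 by (intro divide_left_mono) auto
    with \<open>1 / \<beta> ^ Suc r \<le> 1 / \<beta>\<close> show "w z k \<le> 1 / \<beta>" by simp
  qed
  have "\<forall>z. \<exists>x. \<forall>k. x k \<in> {0..<1} \<and> x k = a k + w z k * x (Suc k)"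
    using a(1) w(1,3) by (intro allI affine_nested_points)
  from choice[OF this]
  obtain X where "\<forall>z k. X z k \<in> {0..<1} \<and> X z k = a k + w z k * X z (Suc k)" ..
  then have X: "X z k \<in> {0..<1}" "X z k = a k + w z k * X z (Suc k)" for z k by blast+
  have normal_iff: "beta_normal \<beta> (X z 0) \<longleftrightarrow> filterlim z at_top sequentially" for z
  proof -
    interpret zero_insertion \<beta> y a z "X z"
    proof
      show "y \<in> {0..<1}" by (rule y(1))
      show "(T ^^ 2 ^ k) (a k + u / \<beta> ^ 2 ^ k) = u" if "u \<in> {0..<1}" for u k
        using that by (rule a(3))
      show "(\<Sum>i<2 ^ k. \<bar>(T ^^ i) (a k + u / \<beta> ^ 2 ^ k) - (T ^^ i) (?y k)\<bar>) \<le> 1 + 2 * \<kappa>"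
        if "u \<in> {0..<1}" for u k
        using that by (rule a(4))
      show "X z k \<in> {0..<1}" for k by (rule X(1))
      show "X z k = a k + 1 / \<beta> ^ (2 ^ k + (1 + 2 ^ k div (z k + 1))) * X z (Suc k)" for k
        using X(2)[of z k] unfolding w_def .
    qed
    show ?thesis using normal_if_diverging[OF y(2)] diverging_if_normal by blast
  qed
  \<comment> \<open>Although each \<open>X z\<close> is picked by choice, the recursion contracts by
    at least \<open>1 / \<beta>\<close> per step, so \<open>n\<close> common entries fix the point
    up to \<open>(1 / \<beta>) ^ n\<close>. This continuity pulls open sets back to finitely
    determined ones.\<close>
  have close: "\<bar>X z k - X z' k\<bar> \<le> (1 / \<beta>) ^ n" if "\<forall>i<n. z' (k + i) = z (k + i)" for n k z z'
    using that
  proof (induction n arbitrary: k)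
    case 0
    then show ?case using X(1)[of z k] X(1)[of z' k] by (auto simp: abs_le_iff)
  next
    case (Suc n)
    have "\<forall>i<n. z' (Suc k + i) = z (Suc k + i)" using Suc.prems by (metis Suc_less_eq add_Suc_shift)
    then have "\<bar>X z (Suc k) - X z' (Suc k)\<bar> \<le> (1 / \<beta>) ^ n" by (rule Suc.IH)
    moreover have "w z' k = w z k" using Suc.prems[rule_format, of 0] by (simp add: w_def)
    then have "X z k - X z' k = w z k * (X z (Suc k) - X z' (Suc k))"
      using X(2)[of z k] X(2)[of z' k] by (simp add: algebra_simps)
    then have "\<bar>X z k - X z' k\<bar> = w z k * \<bar>X z (Suc k) - X z' (Suc k)\<bar>"
      using w(1) by (simp add: abs_mult)
    ultimately show ?case using w(1,2)[of z k] beta_gt_1 by (simp only: power_Suc) (intro mult_mono, auto)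
  qed
  define G where "G i j = {z. X z 0 \<in> U i j}" for i j
  have "finitely_determined (G i j)" for i j
    unfolding finitely_determined_def
  proof
    fix z assume "z \<in> G i j"
    then have "X z 0 \<in> U i j" by (simp add: G_def)
    then obtain e where e: "e > 0" "\<And>x. x \<in> {0..<1} \<Longrightarrow> dist x (X z 0) < e \<Longrightarrow> x \<in> U i j"
      using U[of i j] unfolding openin_euclidean_subtopology_iff by blast
    obtain n where n: "(1 / \<beta>) ^ n < e"
      using real_arch_pow_inv[OF \<open>e > 0\<close>, of "1 / \<beta>"] beta_gt_1 by auto
    show "\<exists>n. \<forall>z'. (\<forall>k<n. z' k = z k) \<longrightarrow> z' \<in> G i j"
    proof (intro exI allI impI)
      fix z' assume "\<forall>k<n. z' k = z k"
      then have "\<bar>X z 0 - X z' 0\<bar> \<le> (1 / \<beta>) ^ n" using close[of n z' 0 z] by simp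
      then have "dist (X z' 0) (X z 0) < e" using n by (simp add: dist_real_def)
      then show "z' \<in> G i j" using e(2) X(1) by (simp add: G_def)
    qed
  qed
  moreover have "{z. filterlim z at_top sequentially} = (\<Union>i. \<Inter>j. G i j)"
  proof (rule set_eqI)
    fix z
    have "filterlim z at_top sequentially \<longleftrightarrow> X z 0 \<in> {x \<in> {0..<1}. beta_normal \<beta> x}"
      using normal_iff X(1) by simp
    also have "\<dots> \<longleftrightarrow> z \<in> (\<Union>i. \<Inter>j. G i j)"
      unfolding eq using X(1)[of z 0] by (simp add: G_def)
    finally show "z \<in> {z. filterlim z at_top sequentially} \<longleftrightarrow> z \<in> (\<Union>i. \<Inter>j. G i j)" by simp
  qed
  ultimately show False using diverging_sequences_not_Sigma03[of G] by blast
qed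

end

theorem corollary16:
  fixes \<beta> :: real
  assumes "\<beta> > 1"
  shows "Pi03_complete_in (top_of_set {0..<1}) {x \<in> {0..<1}. beta_normal \<beta> x}"
proof -
  interpret beta_expansion \<beta> using assms by unfold_locales
  show ?thesis
    unfolding Pi03_complete_in_def using normal_set_Pi03 normal_set_not_Sigma03 by blast
qed

end
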